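(* Let $f$ be a monic irreducible element of $R$ with $f\notin Z(R)$, whose bound is $F(x^n)$ with $F(y)\in\mathbb{K}[y]$ monic irreducible of degree $s$, $F(y)\ne y$, and assume $\deg f=s\ell$ with $\ell=\ell_F$. Let $\rho\in\mathrm{Aut}(\mathbb{L})$, $\mathbb{K}'=\mathrm{Fix}_{\mathbb{L}}(\rho)\cap\mathbb{K}$ with $\mathbb{K}/\mathbb{K}'$ finite, and $\eta\in\mathbb{L}$ with $\mathrm{N}_{\mathbb{L}/\mathbb{K}'}(\eta f_0)\ne1$, $f_0$ the constant coefficient of $f$. Let $z(x^n)\in Z(R)$ satisfy $z(x^n)x^{sn}\equiv1 \pmod{Rf}$. On $R/Rf$ the operation $$\Big((a_0-\eta\rho(a_0)f_0)+\sum_{i=1}^{s\ell-1}a_ix^i\Big)\star_{S'}\sum_{i=0}^{s\ell-1}b_ix^i:=\Big((a_0-\eta\rho(a_0)f_0)+\sum_{i=1}^{s\ell-1}a_ix^i+\eta\rho(a_0)f(x)\Big)z(x^n)x^{sn-1}\sum_{i=0}^{s\ell-1}b_ix^i\bmod_r f$$ defines a unital division algebra over $\mathbb{K}'$ with unity $x$, of dimension $m\ell^2s[\mathbb{K}:\mathbb{K}']$, which is isotopic to the division algebra $(R/Rf,\star_S)$, where $$\Big((a_0-\eta\rho(a_0)f_0)+\sum_{i=1}^{s\ell-1}a_ix^i\Big)\star_S b:=\Big((a_0-\eta\rho(a_0)f_0)+\sum_{i=1}^{s\ell-1}a_ix^i+\eta\rho(a_0)f(x)\Big)b\bmod_r 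f.$$
   Context: $\mathbb{K}$ is a field, $\mathbb{L}/\mathbb{K}$ cyclic Galois of degree $n\ge2$, $\sigma$ a generator of $\mathrm{Gal}(\mathbb{L}/\mathbb{K})$, $R=\mathbb{L}[x;\sigma]$ with $xa=\sigma(a)x$, $Z(R)=\mathbb{K}[x^n]$. The bound of $f$ is the monic central polynomial generating the largest two-sided ideal in $Rf$; $m$ is the number of irreducible factors of $F(x^n)$ in $R$, $\ell_F=n/m$. $R/Rf$ is identified with polynomials of degree $<\deg f$ and $\bmod_r f$ is the remainder of right division by $f$. Under the hypothesis on $\eta$, every element of $R/Rf$ is uniquely of the form $(a_0-\eta\rho(a_0)f_0)+\sum_{i=1}^{s\ell-1}a_ix^i$ with $a_i\in\mathbb{L}$. Such a $z(x^n)$ exists, and $z(x^n)x^{sn-1}$ is the inverse of $x$ modulo $f$. Two algebras $(A,\star)$, $(A',\star')$ are isotopic if there are invertible additive maps $h_1,h_2,h_3:A\to A'$ with $h_1(a\star b)=h_2(a)\star' h_3(b)$ for all $a,b$.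
   Formalization: The claim that x is the unity is stated only for deg f > 1: if deg f = 1, so f = x − c, then x is not a residue of degree < deg f and its class c is never a left unity since σ ≠ id, so no unity exists; all other conclusions are stated without this restriction. *)

theory Defs
  imports
    "HOL-Algebra.Algebraic_Closure_Type"
    "Jordan_Normal_Form.Determinant"
    "HOL-Computational_Algebra.Polynomial"
begin

section \<open>Field extensions inside a field type\<close>

text \<open>The field L is a type; its subfields are sets, and the HOL-Algebra notions
  (subfield, dimension, ring isomorphism) refer to the full type viewed as a ring record.\<close>

abbreviation fullfield :: "'a::field ring"
  where "fullfield \<equiv> ring_of_type_algebra"

definition field_auts :: "('a::field \<Rightarrow> 'a) set"
  where "field_auts = ring_iso fullfield fullfield"

definition gal_group :: "'a::field set \<Rightarrow> ('a \<Rightarrow> 'a) set"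
  where "gal_group K = {\<tau> \<in> field_auts. \<forall>k\<in>K. \<tau> k = k}"

text \<open>L/K is Galois of degree n with cyclic Galois group generated by \<open>\<sigma>\<close>.
  The group is finite, so the nonnegative powers of \<open>\<sigma>\<close> form the subgroup it generates.\<close>

definition cyclic_galois :: "'a::field set \<Rightarrow> ('a \<Rightarrow> 'a) \<Rightarrow> nat \<Rightarrow> bool"
  where "cyclic_galois K \<sigma> n \<longleftrightarrow>
    subfield K fullfield \<and>
    ring.dimension fullfield n K UNIV \<and>
    {a. \<forall>\<tau>\<in>gal_group K. \<tau> a = a} = K \<and>
    \<sigma> \<in> gal_group K \<and>
    gal_group K = range (\<lambda>i::nat. \<sigma> ^^ i)"

text \<open>Norm from L to a subfield K of finite index: the determinant of the K-linear map
  given by multiplication with \<open>a\<close>, computed in any K-basis \<open>us\<close> of L.\<close>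

definition field_norm :: "'a::field set \<Rightarrow> 'a \<Rightarrow> 'a"
  where "field_norm K a = (THE d. \<exists>us M.
    ring.independent fullfield K us \<and> ring.Span fullfield K us = UNIV \<and>
    M \<in> carrier_mat (length us) (length us) \<and>
    (\<forall>i<length us. \<forall>j<length us. M $$ (i, j) \<in> K) \<and>
    (\<forall>j<length us. a * us ! j = (\<Sum>i<length us. M $$ (i, j) * us ! i)) \<and>
    d = det M)"

section \<open>Polynomials over a subfield\<close>

definition subfield_poly_ring :: "'a::field set \<Rightarrow> 'a poly ring"
  where "subfield_poly_ring K = \<lparr>carrier = {p. \<forall>i. poly.coeff p i \<in> K},
    monoid.mult = (*), one = 1, ring.zero = 0, add = (+)\<rparr>"

section \<open>The skew polynomial ring\<close>

text \<open>A skew polynomial with coefficients written on the left is represented by the ordinary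
  polynomial with the same coefficients; only the multiplication is changed.\<close>

definition skew_mult :: "('a::field \<Rightarrow> 'a) \<Rightarrow> 'a poly \<Rightarrow> 'a poly \<Rightarrow> 'a poly"
  where "skew_mult \<sigma> p q =
    (\<Sum>i\<le>Polynomial.degree p. \<Sum>j\<le>Polynomial.degree q.
      Polynomial.monom (poly.coeff p i * (\<sigma> ^^ i) (poly.coeff q j)) (i + j))"

definition skew_poly_ring :: "('a::field \<Rightarrow> 'a) \<Rightarrow> 'a poly ring"
  where "skew_poly_ring \<sigma> = \<lparr>carrier = UNIV,
    monoid.mult = skew_mult \<sigma>, one = 1, ring.zero = 0, add = (+)\<rparr>"

lemma skew_mult_X_const:
  "skew_mult \<sigma> (Polynomial.monom 1 1) [:a:] = Polynomial.monom (\<sigma> a) 1"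
  by (simp add: skew_mult_def degree_monom_eq)

text \<open>\<open>in_power F n\<close> is \<open>F(x\<^sup>n)\<close>. For F with coefficients fixed by \<open>\<sigma>\<close>, ordinary composition
  agrees with evaluation in the skew polynomial ring.\<close>

abbreviation in_power :: "'a::field poly \<Rightarrow> nat \<Rightarrow> 'a poly"
  where "in_power F n \<equiv> pcompose F (Polynomial.monom 1 n)"

definition ring_center :: "('a, 'b) ring_scheme \<Rightarrow> 'a set"
  where "ring_center R = {z \<in> carrier R. \<forall>r\<in>carrier R. z \<otimes>\<^bsub>R\<^esub> r = r \<otimes>\<^bsub>R\<^esub> z}"

text \<open>The library's \<open>irreducible\<close> is built on one-sided divisibility and is meant for commutative
  monoids; here the ring need not be commutative.\<close>

definition nc_irreducible :: "('a, 'b) ring_scheme \<Rightarrow> 'a \<Rightarrow> bool"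
  where "nc_irreducible R p \<longleftrightarrow>
    p \<in> carrier R \<and> p \<noteq> \<zero>\<^bsub>R\<^esub> \<and> p \<notin> Units R \<and>
    (\<forall>a\<in>carrier R. \<forall>b\<in>carrier R. p = a \<otimes>\<^bsub>R\<^esub> b \<longrightarrow> a \<in> Units R \<or> b \<in> Units R)"

definition has_irreducible_factors :: "('a, 'b) ring_scheme \<Rightarrow> 'a \<Rightarrow> nat \<Rightarrow> bool"
  where "has_irreducible_factors R g m \<longleftrightarrow>
    (\<exists>ps. length ps = m \<and> (\<forall>p\<in>set ps. nc_irreducible R p) \<and>
      g = foldr (\<lambda>p q. p \<otimes>\<^bsub>R\<^esub> q) ps \<one>\<^bsub>R\<^esub>)"

text \<open>\<open>PIdl\<^bsub>R\<^esub> f\<close> is the left ideal \<open>Rf\<close>, and \<open>ideal\<close> is the library's two-sided ideal.\<close>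

definition is_bound :: "('a::field \<Rightarrow> 'a) \<Rightarrow> 'a poly \<Rightarrow> 'a poly \<Rightarrow> bool"
  where "is_bound \<sigma> f B \<longleftrightarrow> (let R = skew_poly_ring \<sigma> in
    B \<in> ring_center R \<and> lead_coeff B = 1 \<and>
    ideal (PIdl\<^bsub>R\<^esub> B) R \<and> PIdl\<^bsub>R\<^esub> B \<subseteq> PIdl\<^bsub>R\<^esub> f \<and>
    (\<forall>I. ideal I R \<and> I \<subseteq> PIdl\<^bsub>R\<^esub> f \<longrightarrow> I \<subseteq> PIdl\<^bsub>R\<^esub> B))"

text \<open>Remainder of right division by a nonzero \<open>f\<close>.\<close>

definition skew_mod :: "('a::field \<Rightarrow> 'a) \<Rightarrow> 'a poly \<Rightarrow> 'a poly \<Rightarrow> 'a poly"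
  where "skew_mod \<sigma> g f = (THE r.
    (r = 0 \<or> Polynomial.degree r < Polynomial.degree f) \<and>
    (\<exists>q. g = skew_mult \<sigma> q f + r))"

definition residues_mod :: "'a::field poly \<Rightarrow> 'a poly set"
  where "residues_mod f = {r. r = 0 \<or> Polynomial.degree r < Polynomial.degree f}"

section \<open>The two multiplications\<close>

text \<open>\<open>twist_coeff \<eta> \<rho> f u\<close> is the \<open>a\<^sub>0\<close> for which the constant coefficient of \<open>u\<close> is
  \<open>a\<^sub>0 - \<eta> \<rho>(a\<^sub>0) f\<^sub>0\<close>, and \<open>twist_lift\<close> is the lift \<open>u + \<eta> \<rho>(a\<^sub>0) f\<close> of \<open>u\<close>.\<close>

definition twist_coeff :: "'a::field \<Rightarrow> ('a \<Rightarrow> 'a) \<Rightarrow> 'a poly \<Rightarrow> 'a poly \<Rightarrow> 'a"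
  where "twist_coeff \<eta> \<rho> f u =
    (THE a0. a0 - \<eta> * \<rho> a0 * poly.coeff f 0 = poly.coeff u 0)"

definition twist_lift :: "'a::field \<Rightarrow> ('a \<Rightarrow> 'a) \<Rightarrow> 'a poly \<Rightarrow> 'a poly \<Rightarrow> 'a poly"
  where "twist_lift \<eta> \<rho> f u = u + Polynomial.smult (\<eta> * \<rho> (twist_coeff \<eta> \<rho> f u)) f"

definition star_S :: "('a::field \<Rightarrow> 'a) \<Rightarrow> 'a \<Rightarrow> ('a \<Rightarrow> 'a) \<Rightarrow> 'a poly \<Rightarrow>
    'a poly \<Rightarrow> 'a poly \<Rightarrow> 'a poly"
  where "star_S \<sigma> \<eta> \<rho> f u v = skew_mod \<sigma> (skew_mult \<sigma> (twist_lift \<eta> \<rho> f u) v) f"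

definition star_S' :: "('a::field \<Rightarrow> 'a) \<Rightarrow> 'a \<Rightarrow> ('a \<Rightarrow> 'a) \<Rightarrow> 'a poly \<Rightarrow>
    nat \<Rightarrow> nat \<Rightarrow> 'a poly \<Rightarrow> 'a poly \<Rightarrow> 'a poly \<Rightarrow> 'a poly"
  where "star_S' \<sigma> \<eta> \<rho> f n s z u v =
    skew_mod \<sigma>
      (skew_mult \<sigma>
        (skew_mult \<sigma>
          (skew_mult \<sigma> (twist_lift \<eta> \<rho> f u) (in_power z n))
          (Polynomial.monom 1 (s * n - 1)))
        v) f"

section \<open>Nonassociative algebras\<close>

definition algebra_over :: "'a::field set \<Rightarrow> 'a poly set \<Rightarrow>
    ('a poly \<Rightarrow> 'a poly \<Rightarrow> 'a poly) \<Rightarrow> bool"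
  where "algebra_over k A star \<longleftrightarrow>
    subfield k fullfield \<and>
    0 \<in> A \<and> (\<forall>u\<in>A. \<forall>v\<in>A. u + v \<in> A) \<and> (\<forall>c\<in>k. \<forall>u\<in>A. Polynomial.smult c u \<in> A) \<and>
    (\<forall>u\<in>A. \<forall>v\<in>A. star u v \<in> A) \<and>
    (\<forall>u\<in>A. \<forall>v\<in>A. \<forall>w\<in>A. star (u + v) w = star u w + star v w \<and>
       star w (u + v) = star w u + star w v) \<and>
    (\<forall>c\<in>k. \<forall>u\<in>A. \<forall>v\<in>A.
       star (Polynomial.smult c u) v = Polynomial.smult c (star u v) \<and>
       star u (Polynomial.smult c v) = Polynomial.smult c (star u v))"

definition division_algebra_over :: "'a::field set \<Rightarrow> 'a poly set \<Rightarrow>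
    ('a poly \<Rightarrow> 'a poly \<Rightarrow> 'a poly) \<Rightarrow> bool"
  where "division_algebra_over k A star \<longleftrightarrow>
    algebra_over k A star \<and> A \<noteq> {0} \<and>
    (\<forall>u\<in>A - {0}. bij_betw (\<lambda>v. star u v) A A \<and> bij_betw (\<lambda>v. star v u) A A)"

text \<open>Scalars from \<open>k\<close> act through the constant polynomials of the skew polynomial ring; left
  multiplication by a constant \<open>c\<close> is \<open>smult c\<close>.\<close>

definition algebra_dimension :: "('a::field \<Rightarrow> 'a) \<Rightarrow> 'a set \<Rightarrow> 'a poly set \<Rightarrow> nat \<Rightarrow> bool"
  where "algebra_dimension \<sigma> k A d \<longleftrightarrow>
    ring.dimension (skew_poly_ring \<sigma>) d ((\<lambda>c. [:c:]) ` k) A"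

text \<open>The polynomial \<open>x\<close> is a reduced residue modulo \<open>f\<close> only if \<open>deg f > 1\<close>. If \<open>f = x - c\<close>
  and \<open>\<eta> = 0\<close>, the operation \<open>star_S'\<close> is \<open>(u, v) \<mapsto> u \<sigma>\<^sup>-\<^sup>1(v) / \<sigma>\<^sup>-\<^sup>1(c)\<close>
  on L, which has no unity; hence a claim that \<open>x\<close> is the unity needs \<open>deg f > 1\<close>.\<close>

definition is_unity :: "'v set \<Rightarrow> ('v \<Rightarrow> 'v \<Rightarrow> 'v) \<Rightarrow> 'v \<Rightarrow> bool"
  where "is_unity A star e \<longleftrightarrow> e \<in> A \<and> (\<forall>u\<in>A. star e u = u \<and> star u e = u)"

definition isotopic :: "'v::ab_group_add set \<Rightarrow> ('v \<Rightarrow> 'v \<Rightarrow> 'v) \<Rightarrow>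
    'w::ab_group_add set \<Rightarrow> ('w \<Rightarrow> 'w \<Rightarrow> 'w) \<Rightarrow> bool"
  where "isotopic A star A' star' \<longleftrightarrow> (\<exists>h1 h2 h3.
    (\<forall>h\<in>{h1, h2, h3}. bij_betw h A A' \<and> (\<forall>a\<in>A. \<forall>b\<in>A. h (a + b) = h a + h b)) \<and>
    (\<forall>a\<in>A. \<forall>b\<in>A. h1 (star a b) = star' (h2 a) (h3 b)))"

end

theory Submission
  imports Defs
begin

text \<open>If \<open>g b \<in> Rf\<close> with \<open>b \<notin> Rf\<close> and \<open>g \<noteq> 0\<close>, then \<open>deg g \<ge> deg f\<close>, because \<open>R/Rf\<close> is simple and
  generated by the image of \<open>b\<close>. If moreover \<open>g\<close> is monic of degree \<open>deg f\<close>, then right multiplication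
  by \<open>b\<close> is an isomorphism \<open>R/Rg \<rightarrow> R/Rf\<close>, with matrix \<open>P\<close> in the bases of powers of \<open>x\<close>. Since \<open>x\<close> acts
  \<open>\<sigma>\<close>-semilinearly through companion matrices, \<open>C\<^sub>g P = \<sigma>(P) C\<^sub>f\<close>, and determinants give
  \<open>g\<^sub>0 p = f\<^sub>0 \<sigma>(p)\<close> with \<open>p = det P \<noteq> 0\<close>. A zero divisor of \<open>\<star>\<^sub>S\<close> would yield such a \<open>g\<close> with
  \<open>a\<^sub>0 = \<eta> \<rho>(a\<^sub>0) g\<^sub>0\<close>, so that the norm of \<open>\<eta> f\<^sub>0\<close> would be \<open>1\<close>.

  The second multiplication is \<open>u \<star>\<^sub>S \<phi>(v)\<close>, where \<open>\<phi>\<close>, left multiplication by \<open>z(x\<^sup>n) x\<^sup>s\<^sup>n\<^sup>-\<^sup>1\<close> on \<open>R/Rf\<close>,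
  is inverse to left multiplication by \<open>x\<close>. For the dimension, every irreducible factor of \<open>F(x\<^sup>n)\<close>
  is similar to \<open>f\<close> and has the same degree, hence \<open>n = m l\<close>.\<close>

section \<open>Linear algebra\<close>

text \<open>Zero rows pad the system to a square matrix. Expansion along the padded row
  \<open>r\<close>, which exists because r < c, makes its determinant vanish and yields a kernel
  vector. Coefficients and solution are plain functions, so that families of polynomial coefficients
  or of conjugates can be inserted directly.\<close>

lemma wide_system_has_nontrivial_solution:
  fixes A :: "nat \<Rightarrow> nat \<Rightarrow> 'a::field"
  assumes "r < c"
  shows "\<exists>v. (\<exists>j<c. v j \<noteq> 0) \<and> (\<forall>i<r. (\<Sum>j<c. A i j * v j) = 0)"
proof -
  define M where "M = mat c c (\<lambda>(i, j). if i < r then A i j else 0)"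
  have M: "M \<in> carrier_mat c c" by (simp add: M_def)
  have "det M = (\<Sum>j<c. M $$ (r, j) * cofactor M r j)"
    by (rule laplace_expansion_row[OF M assms])
  also have "\<dots> = 0"
    using assms by (intro sum.neutral) (auto simp: M_def)
  finally obtain w where w: "w \<in> carrier_vec c" "w \<noteq> 0\<^sub>v c" "M *\<^sub>v w = 0\<^sub>v c"
    using det_0_iff_vec_prod_zero_field[OF M] by auto
  show ?thesis
  proof (intro exI[of _ "\<lambda>j. w $ j"] conjI allI impI)
    show "\<exists>j<c. w $ j \<noteq> 0"
      using w(1,2) by (auto simp: vec_eq_iff)
  next
    fix i assume i: "i < r"
    have "(M *\<^sub>v w) $ i = (\<Sum>j<c. A i j * w $ j)"
      using i assms w(1) by (auto simp: M_def scalar_prod_def row_def lessThan_atLeast0 intro!: sum.cong)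
    thus "(\<Sum>j<c. A i j * w $ j) = 0"
      using w(3) i assms by simp
  qed
qed

text \<open>An injective linear map sends a basis to an independent list of full length, which
  therefore spans. The setting of a subspace of an arbitrary ring covers both L over its subfield
  and the residues inside the noncommutative ring R.\<close>

lemma (in ring) injective_linear_endo_surj:
  assumes K: "subfield K R" and dim: "dimension n K E"
    and closed: "\<And>v. v \<in> E \<Longrightarrow> \<phi> v \<in> E"
    and add: "\<And>u v. u \<in> E \<Longrightarrow> v \<in> E \<Longrightarrow> \<phi> (u \<oplus> v) = \<phi> u \<oplus> \<phi> v"
    and scale: "\<And>k v. k \<in> K \<Longrightarrow> v \<in> E \<Longrightarrow> \<phi> (k \<otimes> v) = k \<otimes> \<phi> v"
    and ker: "\<And>v. v \<in> E \<Longrightarrow> \<phi> v = \<zero> \<Longrightarrow> v = \<zero>"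
  shows "\<phi> ` E = E"
proof -
  note E = space_subgroup_props[OF K dim]
  have K0: "\<zero> \<in> K" using subringE(2)[OF subfieldE(1)[OF K]] .
  have \<phi>0: "\<phi> \<zero> = \<zero>"
    using scale[OF K0 E(2)] E(1,2) closed[OF E(2)] by auto
  obtain Us where Us: "set Us \<subseteq> carrier R" "independent K Us" "length Us = n" "Span K Us = E"
    using exists_base[OF K dim] by auto
  have UsE: "set Us \<subseteq> E" using Span_base_incl[OF K Us(1)] Us(4) by simp
  have comb: "combine Ks Vs \<in> E \<and> \<phi> (combine Ks Vs) = combine Ks (map \<phi> Vs)"
    if "set Ks \<subseteq> K" "set Vs \<subseteq> E" for Ks Vs
    using that by (induct Ks Vs rule: combine.induct) (auto simp: \<phi>0 E add scale)
  have \<phi>Us: "set (map \<phi> Us) \<subseteq> E" using UsE closed by auto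
  have indep: "independent K (map \<phi> Us)"
  proof (rule trivial_combine_imp_independent[OF K])
    show "set (map \<phi> Us) \<subseteq> carrier R" using \<phi>Us E(1) by auto
    fix Ks assume Ks: "set Ks \<subseteq> K" "combine Ks (map \<phi> Us) = \<zero>"
    hence "combine Ks Us = \<zero>" using comb[OF Ks(1) UsE] ker by auto
    from independent_imp_trivial_combine[OF K Us(2) Ks(1) this]
    show "set (take (length (map \<phi> Us)) Ks) \<subseteq> {\<zero>}" by simp
  qed
  have span: "Span K (map \<phi> Us) = E"
    using independent_length_eq_dimension[OF K dim indep \<phi>Us] Us(3) by simp
  show ?thesis
  proof
    show "\<phi> ` E \<subseteq> E" using closed by auto
    show "E \<subseteq> \<phi> ` E"
    proof
      fix v assume "v \<in> E"
      then obtain Ks where "set Ks \<subseteq> K" "v = combine Ks (map \<phi> Us)"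
        using span Span_mem_iff_length_version[OF K, of "map \<phi> Us" v] \<phi>Us E(1) by auto
      thus "v \<in> \<phi> ` E" using comb[OF _ UsE] by (metis imageI)
    qed
  qed
qed

section \<open>Bases and automorphisms of a field type\<close>

lemma fullfield_simps [simp]:
  "carrier (fullfield :: 'a::field ring) = UNIV"
  "x \<otimes>\<^bsub>fullfield\<^esub> y = x * (y :: 'a)"
  "x \<oplus>\<^bsub>fullfield\<^esub> y = x + y"
  "\<one>\<^bsub>fullfield\<^esub> = (1 :: 'a)"
  "\<zero>\<^bsub>fullfield\<^esub> = (0 :: 'a)"
  by (simp_all add: ring_of_type_algebra_def)

interpretation fullfield: ring "fullfield :: 'a::field ring"
  by (rule ring_from_type_algebra)

lemma fullfield_uminus [simp]: "\<ominus>\<^bsub>fullfield\<^esub> (x :: 'a::field) = - x"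
  by (metis fullfield.add.inv_equality fullfield_simps UNIV_I add.right_inverse add.commute)

lemma fullfield_inv: "(x :: 'a::field) \<noteq> 0 \<Longrightarrow> inv\<^bsub>fullfield\<^esub> x = inverse x"
  by (rule fullfield.inv_char) auto

lemma subfield_fullfieldD:
  fixes K :: "'a::field set"
  assumes "subfield K fullfield"
  shows "0 \<in> K" "1 \<in> K" "\<And>x y. x \<in> K \<Longrightarrow> y \<in> K \<Longrightarrow> x + y \<in> K"
    "\<And>x y. x \<in> K \<Longrightarrow> y \<in> K \<Longrightarrow> x * y \<in> K" "\<And>x. x \<in> K \<Longrightarrow> - x \<in> K"
    "\<And>x. x \<in> K \<Longrightarrow> inverse x \<in> K"
proof -
  note S = subringE[OF subfieldE(1)[OF assms]]
  show 0: "0 \<in> K" and "1 \<in> K" using S(2,3) by auto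
  show "\<And>x y. x \<in> K \<Longrightarrow> y \<in> K \<Longrightarrow> x + y \<in> K" using S(7) by auto
  show "\<And>x y. x \<in> K \<Longrightarrow> y \<in> K \<Longrightarrow> x * y \<in> K" using S(6) by auto
  show "\<And>x. x \<in> K \<Longrightarrow> - x \<in> K" using S(5) by auto
  show "inverse x \<in> K" if "x \<in> K" for x
    using fullfield.subfield_m_inv(1)[OF assms, of x] that 0 by (cases "x = 0") (auto simp: fullfield_inv)
qed

lemma subfield_sum_closed:
  fixes K :: "'a::field set"
  assumes "subfield K fullfield" "\<And>i. i \<in> I \<Longrightarrow> g i \<in> K"
  shows "sum g I \<in> K"
  using assms(2) by (induct I rule: infinite_finite_induct) (auto intro: subfield_fullfieldD[OF assms(1)])

lemma fullfield_combine:
  "length Ks = length Us \<Longrightarrow> fullfield.combine Ks Us = (\<Sum>i<length Us. Ks ! i * Us ! i :: 'a::field)"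
  by (induct rule: list_induct2) (simp_all add: sum.lessThan_Suc_shift del: sum.lessThan_Suc)

text \<open>These are the two conditions on \<open>us\<close> under the existential of
  \<open>field_norm\<close>.\<close>

definition field_basis :: "'a::field set \<Rightarrow> 'a list \<Rightarrow> bool"
  where "field_basis K us \<longleftrightarrow> fullfield.independent K us \<and> fullfield.Span K us = UNIV"

lemma field_basis_expansion:
  assumes "subfield K fullfield" "field_basis K us"
  shows "\<exists>c. (\<forall>i. c i \<in> K) \<and> a = (\<Sum>i<length us. c i * us ! i)"
proof -
  obtain Ks where Ks: "set Ks \<subseteq> K" "length Ks = length us" "a = fullfield.combine Ks us"
    using fullfield.Span_mem_iff_length_version[OF assms(1), of us a] assms(2) by (auto simp: field_basis_def)
  show ?thesis
  \<comment> \<open>Padding with 0 beyond the end of the list keeps all values of the coefficient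
    function in \<open>K\<close>.\<close>
  proof (intro exI[of _ "\<lambda>i. if i < length us then Ks ! i else 0"] conjI allI)
    show "(if i < length us then Ks ! i else 0) \<in> K" for i
      using Ks(1,2) subfield_fullfieldD(1)[OF assms(1)] by auto
  qed (simp add: Ks(3) fullfield_combine[OF Ks(2)])
qed

lemma field_basis_unique:
  assumes "subfield K fullfield" "field_basis K us"
    and "\<And>i. i < length us \<Longrightarrow> c i \<in> K" "(\<Sum>i<length us. c i * us ! i) = 0" "i < length us"
  shows "c i = 0"
proof -
  let ?Ks = "map c [0..<length us]"
  have "fullfield.combine ?Ks us = 0"
    using assms(4) by (simp add: fullfield_combine)
  moreover have "set ?Ks \<subseteq> K" using assms(3) by auto
  ultimately have "set (take (length us) ?Ks) \<subseteq> {0}"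
    using fullfield.independent_imp_trivial_combine[OF assms(1), of us ?Ks] assms(2)
    by (simp add: field_basis_def)
  hence "set ?Ks \<subseteq> {0}" by simp
  moreover have "c i \<in> set ?Ks" using assms(5) by auto
  ultimately show ?thesis by blast
qed

lemma field_basisI:
  assumes K: "subfield K fullfield"
    and ex: "\<And>a. \<exists>c. (\<forall>i. c i \<in> K) \<and> a = (\<Sum>i<length us. c i * us ! i)"
    and un: "\<And>c i. (\<And>i. i < length us \<Longrightarrow> c i \<in> K) \<Longrightarrow> (\<Sum>i<length us. c i * us ! i) = 0 \<Longrightarrow>
       i < length us \<Longrightarrow> c i = 0"
  shows "field_basis K us"
  unfolding field_basis_def
proof
  show "fullfield.independent K us"
  proof (rule ccontr)
    assume dep: "\<not> ?thesis"
    obtain Ks where Ks: "length Ks = length us" "fullfield.combine Ks us = \<zero>\<^bsub>fullfield\<^esub>" "set Ks \<subseteq> K" "set Ks \<noteq> {\<zero>\<^bsub>fullfield\<^esub>}"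
      using fullfield.dependent_imp_non_trivial_combine[OF K _ dep] by auto
    \<comment> \<open>The empty list is independent. Hence \<open>Ks\<close> is nonempty, and
      vanishing of all its entries forces \<open>set Ks\<close> to be exactly the singleton of zero
      that nontriviality forbids.\<close>
    have "us \<noteq> []" using dep by auto
    hence ne: "set Ks \<noteq> {}" using Ks(1) by auto
    have "Ks ! i \<in> K" if "i < length us" for i
      using that Ks(1,3) nth_mem[of i Ks] by auto
    hence "Ks ! i = 0" if "i < length us" for i
      using un[of "\<lambda>i. Ks ! i" i] Ks(1,2) that by (simp add: fullfield_combine)
    hence "set Ks \<subseteq> {0}" using Ks(1) by (auto simp: in_set_conv_nth)
    with ne have "set Ks = {0}" by (metis subset_singletonD)
    thus False using Ks(4) by simp
  qed
  show "fullfield.Span K us = UNIV"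
  proof (intro equalityI subsetI UNIV_I)
    fix a
    obtain c where c: "\<And>i. c i \<in> K" "a = (\<Sum>i<length us. c i * us ! i)" using ex by blast
    have "a = fullfield.combine (map c [0..<length us]) us"
      by (simp add: fullfield_combine c(2))
    thus "a \<in> fullfield.Span K us"
      using fullfield.Span_mem_iff_length_version[OF K, of us a] c(1)
      by (intro iffD2[OF fullfield.Span_mem_iff_length_version[OF K]]) (auto intro!: exI[of _ "map c [0..<length us]"])
  qed
qed

lemma field_basis_exists:
  assumes "subfield K fullfield" "fullfield.dimension n K (UNIV :: 'a::field set)"
  shows "\<exists>us. field_basis K us \<and> length us = n"
  using fullfield.exists_base[OF assms] by (auto simp: field_basis_def)

lemma field_basis_length:
  assumes "subfield K fullfield" "field_basis K us" "field_basis K vs"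
  shows "length us = length vs"
  using fullfield.dimensionI[OF assms(1)] fullfield.dimension_is_inj[OF assms(1)] assms(2,3)
  by (metis field_basis_def)

section \<open>Field automorphisms, independence of characters and the order of \<sigma>\<close>

lemma field_autsD:
  assumes "\<tau> \<in> field_auts"
  shows "\<tau> (x + y) = \<tau> x + \<tau> y" "\<tau> (x * y) = \<tau> x * \<tau> y" "\<tau> 1 = 1" "bij \<tau>"
  using assms by (auto simp: field_auts_def ring_iso_def Ring.ring_hom_def)

lemma field_autsI:
  assumes "\<And>x y. \<tau> (x + y) = \<tau> x + \<tau> y" "\<And>x y. \<tau> (x * y) = \<tau> x * \<tau> y" "\<tau> 1 = 1" "bij \<tau>"
  shows "\<tau> \<in> field_auts"
  using assms by (auto simp: field_auts_def ring_iso_def Ring.ring_hom_def)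

lemma field_auts_simps:
  assumes "\<tau> \<in> field_auts"
  shows "\<tau> 0 = 0" "\<tau> (- x) = - \<tau> x" "\<tau> (x - y) = \<tau> x - \<tau> y" "\<tau> x = 0 \<longleftrightarrow> x = 0"
    "\<tau> (sum g I) = (\<Sum>i\<in>I. \<tau> (g i))" "\<tau> (inverse x) = inverse (\<tau> x)"
proof -
  note D = field_autsD[OF assms]
  have "\<tau> 0 + \<tau> 0 = \<tau> 0 + 0" using D(1)[of 0 0] by simp
  thus 0: "\<tau> 0 = 0" by (simp only: add_left_cancel)
  show m: "\<tau> (- x) = - \<tau> x" for x using D(1)[of x "- x"] 0 by (simp add: eq_neg_iff_add_eq_0 add.commute)
  show "\<tau> (x - y) = \<tau> x - \<tau> y" using D(1)[of x "- y"] m by simp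
  show "\<tau> x = 0 \<longleftrightarrow> x = 0" using 0 bij_is_inj[OF D(4)] by (metis injD)
  show "\<tau> (sum g I) = (\<Sum>i\<in>I. \<tau> (g i))"
    by (induct I rule: infinite_finite_induct) (auto simp: 0 D)
  show "\<tau> (inverse x) = inverse (\<tau> x)"
  proof (cases "x = 0")
    case False
    hence "\<tau> x * \<tau> (inverse x) = 1" using D(2,3) by (metis right_inverse)
    thus ?thesis using inverse_unique by metis
  qed (simp add: 0)
qed

lemma field_auts_funpow: "\<tau> \<in> field_auts \<Longrightarrow> \<tau> ^^ i \<in> field_auts"
proof (induct i)
  case 0
  show ?case by (rule field_autsI) (auto simp: bij_def inj_def)
next
  case (Suc i)
  show ?case
    using field_autsD[OF Suc(2)] field_autsD[OF Suc(1)[OF Suc(2)]]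
    by (intro field_autsI) (auto intro: bij_comp[unfolded comp_def])
qed

text \<open>Dedekind's argument: for y separating \<open>\<tau> j\<close> from
  \<open>\<tau> N\<close>, the relation at y * a minus \<open>\<tau> N y\<close> times the relation
  at a has no term in \<open>\<tau> N\<close>, so induction applies. Evaluation at 1 then kills the
  last coefficient.\<close>

lemma field_auts_linear_independent:
  fixes \<tau> :: "nat \<Rightarrow> 'a::field \<Rightarrow> 'a"
  assumes "\<And>i. i < N \<Longrightarrow> \<tau> i \<in> field_auts" "inj_on \<tau> {..<N}"
    and "\<And>a. (\<Sum>i<N. c i * \<tau> i a) = 0" "i < N"
  shows "c i = 0"
  using assms
proof (induct N arbitrary: c i)
  case 0
  thus ?case by simp
next
  case (Suc N)
  have lower: "c j = 0" if j: "j < N" for j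
  proof -
    have "\<tau> j \<noteq> \<tau> N" using Suc(3) j by (auto simp: inj_on_def)
    then obtain y where y: "\<tau> j y \<noteq> \<tau> N y" by auto
    have "(\<Sum>i<N. (c i * (\<tau> i y - \<tau> N y)) * \<tau> i a) = 0" for a
    proof -
      have "(\<Sum>i<Suc N. c i * \<tau> i (y * a)) - \<tau> N y * (\<Sum>i<Suc N. c i * \<tau> i a) = 0"
        using Suc(4) by simp
      moreover have "(\<Sum>i<Suc N. c i * \<tau> i (y * a)) = (\<Sum>i<Suc N. c i * (\<tau> i y * \<tau> i a))"
        using field_autsD(2)[OF Suc(2)] by (intro sum.cong) auto
      ultimately have "(\<Sum>i<Suc N. c i * (\<tau> i y * \<tau> i a) - \<tau> N y * (c i * \<tau> i a)) = 0"
        by (simp add: sum_distrib_left sum_subtractf del: sum.lessThan_Suc)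
      thus ?thesis by (simp add: algebra_simps)
    qed
    from Suc(1)[OF _ _ this j] Suc(2,3) have "c j * (\<tau> j y - \<tau> N y) = 0"
      by (auto simp: inj_on_def)
    thus ?thesis using y by simp
  qed
  have "c N * \<tau> N 1 = 0" using Suc(4)[of 1] lower by simp
  hence "c N = 0" using field_autsD(3)[OF Suc(2)[of N]] by simp
  thus ?case using lower Suc(5) by (auto simp: less_Suc_eq)
qed

text \<open>Centrality of x^n rests on this identity. In \<open>cyclic_galois\<close> the number n
  is the dimension of L over K, so it has to be identified with the order of \<sigma>.\<close>

lemma cyclic_galois_funpow_eq_id:
  assumes "cyclic_galois K \<sigma> n"
  shows "\<sigma> ^^ n = (id :: 'a::field \<Rightarrow> 'a)"
proof -
  have K: "subfield K fullfield" and dim: "fullfield.dimension n K UNIV"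
    and fixed: "{a. \<forall>\<tau>\<in>gal_group K. \<tau> a = a} = K"
    and gal: "\<sigma> \<in> gal_group K" and range: "gal_group K = range (\<lambda>i::nat. \<sigma> ^^ i)"
    using assms by (auto simp: cyclic_galois_def)
  have \<sigma>: "\<sigma> \<in> field_auts" using gal by (simp add: gal_group_def)
  note pow = field_auts_funpow[OF \<sigma>]
  have powK: "(\<sigma> ^^ i) k = k" if "k \<in> K" for i k
    using range that by (auto simp: gal_group_def set_eq_iff)
  have cancel: "\<sigma> ^^ (j - i) = id" if "i < j" "\<sigma> ^^ i = \<sigma> ^^ j" for i j
  proof
    fix a
    have "(\<sigma> ^^ i) ((\<sigma> ^^ (j - i)) a) = (\<sigma> ^^ i) a"
      using that by (metis funpow_add comp_apply le_add_diff_inverse less_imp_le)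
    thus "(\<sigma> ^^ (j - i)) a = id a"
      using bij_is_inj[OF field_autsD(4)[OF pow]] by (simp add: inj_eq)
  qed
  have fixK: "a \<in> K" if "\<sigma> a = a" for a
  proof -
    have "(\<sigma> ^^ i) a = a" for i by (induct i) (auto simp: that)
    hence "a \<in> {a. \<forall>\<tau>\<in>gal_group K. \<tau> a = a}" unfolding range by auto
    thus ?thesis using fixed by simp
  qed
  obtain us where us: "field_basis K us" "length us = n"
    using field_basis_exists[OF K dim] by auto
  \<comment> \<open>Independence of characters bounds the order of \<open>\<sigma>\<close> by \<open>n\<close>; Artin's trace argument gives the
    converse bound.\<close>
  have "\<not> inj_on (\<lambda>i. \<sigma> ^^ i) {..<Suc n}"
  proof
    assume inj: "inj_on (\<lambda>i. \<sigma> ^^ i) {..<Suc n}"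
    \<comment> \<open>A relation among n + 1 powers of \<sigma> on the n basis elements: n equations
      in n + 1 unknowns. It extends to all of L because the powers are K-linear.\<close>
    obtain c where c: "\<exists>i<Suc n. c i \<noteq> 0" "\<forall>j<n. (\<Sum>i<Suc n. (\<sigma> ^^ i) (us ! j) * c i) = 0"
      using wide_system_has_nontrivial_solution[of n "Suc n" "\<lambda>j i. (\<sigma> ^^ i) (us ! j)"] by auto
    have "(\<Sum>i<Suc n. c i * (\<sigma> ^^ i) a) = 0" for a
    proof -
      obtain b where b: "\<And>j. b j \<in> K" "a = (\<Sum>j<n. b j * us ! j)"
        using field_basis_expansion[OF K us(1)] us(2) by metis
      have "(\<Sum>i<Suc n. c i * (\<sigma> ^^ i) a) = (\<Sum>i<Suc n. \<Sum>j<n. b j * ((\<sigma> ^^ i) (us ! j) * c i))"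
        unfolding b(2) field_auts_simps(5)[OF pow] field_autsD(2)[OF pow] powK[OF b(1)] sum_distrib_left
        by (intro sum.cong refl) (simp add: algebra_simps)
      also have "\<dots> = (\<Sum>j<n. b j * (\<Sum>i<Suc n. (\<sigma> ^^ i) (us ! j) * c i))"
        unfolding sum_distrib_left by (rule sum.swap)
      finally show ?thesis using c(2) by (simp del: sum.lessThan_Suc)
    qed
    from field_auts_linear_independent[OF pow inj this] c(1) show False by blast
  qed
  then obtain i j where ij: "i < j" "j \<le> n" "\<sigma> ^^ i = \<sigma> ^^ j"
    unfolding inj_on_def by (metis lessThan_iff less_Suc_eq_le linorder_neqE_nat)
  have "\<sigma> ^^ (j - i) = id" by (rule cancel) (use ij in auto)
  moreover have le: "j - i \<le> n" "0 < j - i" using ij by auto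
  ultimately have ex: "\<exists>N>0. \<sigma> ^^ N = id" by blast
  define N where "N = (LEAST N. 0 < N \<and> \<sigma> ^^ N = id)"
  have N: "0 < N" "\<sigma> ^^ N = id" using LeastI_ex[OF ex] by (auto simp: N_def)
  have min: "N \<le> M" if "0 < M" "\<sigma> ^^ M = id" for M using that by (auto simp: N_def intro: Least_le)
  have "N \<le> n" using min[OF le(2) \<open>\<sigma> ^^ (j - i) = id\<close>] le(1) by simp
  have injN: "inj_on (\<lambda>i. \<sigma> ^^ i) {..<N}"
  proof -
    have False if "i < j" "j < N" "\<sigma> ^^ i = \<sigma> ^^ j" for i j
    proof -
      have "\<sigma> ^^ (j - i) = id" by (rule cancel) (use that in auto)
      from min[OF _ this] that show False by auto
    qed
    thus ?thesis unfolding inj_on_def by (metis lessThan_iff linorder_neqE_nat)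
  qed
  have "\<not> N < n"
  proof
    assume "N < n"
    \<comment> \<open>If the order N were less than n, the N by n matrix of conjugates of the basis
      would have a kernel vector \<open>v\<close>. It will be used to show that the trace to K
      vanishes identically.\<close>
    obtain v where v: "\<exists>j<n. v j \<noteq> 0" "\<forall>i<N. (\<Sum>j<n. (\<sigma> ^^ i) (us ! j) * v j) = 0"
      using wide_system_has_nontrivial_solution[OF \<open>N < n\<close>, of "\<lambda>i j. (\<sigma> ^^ i) (us ! j)"] by auto
    define Tr where "Tr a = (\<Sum>i<N. (\<sigma> ^^ i) a)" for a
    have "Tr a \<in> K" for a
    proof (rule fixK)
      have "\<sigma> (Tr a) = (\<Sum>i<N. (\<sigma> ^^ (Suc i)) a)"
        by (simp add: Tr_def field_auts_simps(5)[OF \<sigma>])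
      also have "\<dots> = (\<Sum>i<Suc N. (\<sigma> ^^ i) a) - a"
        by (simp add: sum.lessThan_Suc_shift del: sum.lessThan_Suc)
      also have "\<dots> = Tr a" using N by (simp add: Tr_def)
      finally show "\<sigma> (Tr a) = Tr a" .
    qed
    note TrK = this
    have twisted: "(\<Sum>j<n. us ! j * (\<sigma> ^^ i) (v j)) = 0" if i: "i < N" for i
    proof -
      \<comment> \<open>The exponent inverse to i modulo N. The case i = 0 is separate because k has
        to stay below N. Applying \<sigma>^i to equation k moves the conjugation from the basis
        elements to \<open>v\<close>.\<close>
      define k where "k = (if i = 0 then 0 else N - i)"
      have k: "k < N" "\<And>a. (\<sigma> ^^ i) ((\<sigma> ^^ k) a) = a"
        using i N by (auto simp: k_def) (metis comp_apply funpow_add id_apply le_add_diff_inverse less_imp_le)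
      have "(\<sigma> ^^ i) (\<Sum>j<n. (\<sigma> ^^ k) (us ! j) * v j) = 0"
        using v(2) k(1) field_auts_simps(1)[OF pow] by simp
      thus ?thesis by (simp add: field_auts_simps(5)[OF pow] field_autsD(2)[OF pow] k(2))
    qed
    \<comment> \<open>For fixed \<mu> the traces of \<open>\<mu> * v j\<close> lie in K and are the
      coefficients of a linear combination of the basis. Interchanging the sums exhibits the left
      sides of \<open>twisted\<close>, so the combination is zero.\<close>
    have Tr0: "Tr (\<mu> * v j) = 0" if j: "j < n" for \<mu> j
    proof (rule field_basis_unique[OF K us(1), of "\<lambda>j. Tr (\<mu> * v j)"])
      have "(\<Sum>j<n. Tr (\<mu> * v j) * us ! j) = (\<Sum>j<n. \<Sum>i<N. (\<sigma> ^^ i) \<mu> * (us ! j * (\<sigma> ^^ i) (v j)))"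
        unfolding Tr_def sum_distrib_right by (intro sum.cong refl) (simp add: field_autsD(2)[OF pow])
      also have "\<dots> = (\<Sum>i<N. (\<sigma> ^^ i) \<mu> * (\<Sum>j<n. us ! j * (\<sigma> ^^ i) (v j)))"
        unfolding sum_distrib_left by (rule sum.swap)
      finally show "(\<Sum>j<length us. Tr (\<mu> * v j) * us ! j) = 0" using twisted us(2) by simp
    qed (use TrK j us(2) in auto)
    obtain j where j: "j < n" "v j \<noteq> 0" using v(1) by auto
    \<comment> \<open>Since \<open>v j\<close> is nonzero, \<mu> can be chosen to make the argument
      of the trace arbitrary. A vanishing trace is a relation among distinct automorphisms with all
      coefficients 1.\<close>
    have "Tr a = 0" for a using Tr0[OF j(1), of "a / v j"] j(2) by simp
    hence "(\<Sum>i<N. 1 * (\<sigma> ^^ i) a) = 0" for a by (simp add: Tr_def)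
    from field_auts_linear_independent[OF pow injN this N(1)] show False by simp
  qed
  with \<open>N \<le> n\<close> N(2) show ?thesis by simp
qed

section \<open>The norm\<close>

definition mult_matrix :: "'a::field set \<Rightarrow> 'a list \<Rightarrow> 'a \<Rightarrow> 'a mat \<Rightarrow> bool"
  where "mult_matrix K us a M \<longleftrightarrow>
    M \<in> carrier_mat (length us) (length us) \<and>
    (\<forall>i<length us. \<forall>j<length us. M $$ (i, j) \<in> K) \<and>
    (\<forall>j<length us. a * us ! j = (\<Sum>i<length us. M $$ (i, j) * us ! i))"

lemma linear_combination_matrix_mult:
  fixes P Q :: "'a::field mat"
  assumes "P \<in> carrier_mat N N" "Q \<in> carrier_mat N N" "j < N"
  shows "(\<Sum>i<N. Q $$ (i, j) * (\<Sum>k<N. P $$ (k, i) * u k)) = (\<Sum>k<N. (P * Q) $$ (k, j) * u k)"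
proof -
  have "(\<Sum>i<N. Q $$ (i, j) * (\<Sum>k<N. P $$ (k, i) * u k)) = (\<Sum>i<N. \<Sum>k<N. P $$ (k, i) * Q $$ (i, j) * u k)"
    unfolding sum_distrib_left by (intro sum.cong refl) (simp add: algebra_simps)
  also have "\<dots> = (\<Sum>k<N. \<Sum>i<N. P $$ (k, i) * Q $$ (i, j) * u k)" by (rule sum.swap)
  also have "\<dots> = (\<Sum>k<N. (P * Q) $$ (k, j) * u k)"
    using assms by (intro sum.cong refl)
      (auto simp: scalar_prod_def sum_distrib_right lessThan_atLeast0)
  finally show ?thesis .
qed

lemma subfield_mat_mult:
  assumes "subfield K fullfield" "P \<in> carrier_mat N N" "Q \<in> carrier_mat N N"
    and "\<And>i j. i < N \<Longrightarrow> j < N \<Longrightarrow> P $$ (i, j) \<in> K" "\<And>i j. i < N \<Longrightarrow> j < N \<Longrightarrow> Q $$ (i, j) \<in> K"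
    and "i < N" "j < N"
  shows "(P * Q) $$ (i, j) \<in> K"
proof -
  have "(P * Q) $$ (i, j) = (\<Sum>k<N. P $$ (i, k) * Q $$ (k, j))"
    using assms(2,3,6,7) by (auto simp: scalar_prod_def lessThan_atLeast0)
  thus ?thesis
    using assms by (auto intro!: subfield_sum_closed[OF assms(1)] subfield_fullfieldD(4)[OF assms(1)])
qed

text \<open>Columns hold coordinates of elements of L. The identities for the change of basis are
  obtained from this by comparing the elements that the columns represent.\<close>

lemma matrix_eq_if_same_combinations:
  assumes K: "subfield K fullfield" and us: "field_basis K us" "length us = N"
    and "P \<in> carrier_mat N N" "Q \<in> carrier_mat N N"
    and "\<And>i j. i < N \<Longrightarrow> j < N \<Longrightarrow> P $$ (i, j) \<in> K" "\<And>i j. i < N \<Longrightarrow> j < N \<Longrightarrow> Q $$ (i, j) \<in> K"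
    and eq: "\<And>j. j < N \<Longrightarrow> (\<Sum>i<N. P $$ (i, j) * us ! i) = (\<Sum>i<N. Q $$ (i, j) * us ! i)"
  shows "P = Q"
proof (rule eq_matI)
  fix i j assume "i < dim_row Q" "j < dim_col Q"
  hence ij: "i < N" "j < N" using assms(5) by auto
  have "P $$ (i, j) - Q $$ (i, j) = 0"
  proof (rule field_basis_unique[OF K us(1), of "\<lambda>i. P $$ (i, j) - Q $$ (i, j)"])
    show "(\<Sum>i<length us. (P $$ (i, j) - Q $$ (i, j)) * us ! i) = 0"
      using eq[OF ij(2)] us(2) by (simp add: left_diff_distrib sum_subtractf)
    show "P $$ (i, j) - Q $$ (i, j) \<in> K" if "i < length us" for i
      using that us(2) ij assms(6,7) subfield_fullfieldD(3)[OF K, of "P $$ (i, j)" "- Q $$ (i, j)"]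
        subfield_fullfieldD(5)[OF K] by auto
  qed (use us(2) ij in auto)
  thus "P $$ (i, j) = Q $$ (i, j)" by simp
qed (use assms in auto)

lemma change_of_basis_matrix:
  assumes K: "subfield K fullfield" and us: "field_basis K us" "length us = N"
  shows "\<exists>P. P \<in> carrier_mat N N \<and> (\<forall>i<N. \<forall>j<N. P $$ (i, j) \<in> K) \<and>
    (\<forall>j<N. w j = (\<Sum>i<N. P $$ (i, j) * us ! i))"
proof -
  have "\<forall>j. \<exists>c. (\<forall>i. c i \<in> K) \<and> w j = (\<Sum>i<N. c i * us ! i)"
    using field_basis_expansion[OF K us(1)] us(2) by auto
  then obtain c where "\<forall>j. (\<forall>i. c j i \<in> K) \<and> w j = (\<Sum>i<N. c j i * us ! i)" by metis
  thus ?thesis by (intro exI[of _ "mat N N (\<lambda>(i, j). c j i)"]) auto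
qed

lemma mult_matrix_exists:
  assumes "subfield K fullfield" "field_basis K us"
  shows "\<exists>M. mult_matrix K us a M"
  using change_of_basis_matrix[OF assms refl, of "\<lambda>j. a * us ! j"] by (auto simp: mult_matrix_def)

text \<open>With \<open>P\<close> expressing \<open>vs\<close> in \<open>us\<close>, column j of
  both \<open>M * P\<close> and \<open>P * M'\<close> holds the coordinates of
  \<open>a * vs ! j\<close> in \<open>us\<close>. Since \<open>P\<close> is invertible, the
  determinants agree, which makes the definite description in \<open>field_norm\<close>
  meaningful.\<close>

lemma det_mult_matrix_basis_independent:
  assumes K: "subfield K fullfield" and us: "field_basis K us" and vs: "field_basis K vs"
    and M: "mult_matrix K us a M" and M': "mult_matrix K vs a M'"
  shows "det M = det M'"
proof -
  define N where "N = length us"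
  have N: "length us = N" "length vs = N" using field_basis_length[OF K us vs] by (auto simp: N_def)
  obtain P where P: "P \<in> carrier_mat N N" "\<And>i j. i < N \<Longrightarrow> j < N \<Longrightarrow> P $$ (i, j) \<in> K"
    "\<And>j. j < N \<Longrightarrow> vs ! j = (\<Sum>i<N. P $$ (i, j) * us ! i)"
    using change_of_basis_matrix[OF K us N(1), of "\<lambda>j. vs ! j"] by auto
  obtain Q where Q: "Q \<in> carrier_mat N N" "\<And>i j. i < N \<Longrightarrow> j < N \<Longrightarrow> Q $$ (i, j) \<in> K"
    "\<And>j. j < N \<Longrightarrow> us ! j = (\<Sum>i<N. Q $$ (i, j) * vs ! i)"
    using change_of_basis_matrix[OF K vs N(2), of "\<lambda>j. us ! j"] by auto
  have M: "M \<in> carrier_mat N N" "\<And>i j. i < N \<Longrightarrow> j < N \<Longrightarrow> M $$ (i, j) \<in> K"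
    "\<And>j. j < N \<Longrightarrow> a * us ! j = (\<Sum>i<N. M $$ (i, j) * us ! i)"
    using M N by (auto simp: mult_matrix_def)
  have M': "M' \<in> carrier_mat N N" "\<And>i j. i < N \<Longrightarrow> j < N \<Longrightarrow> M' $$ (i, j) \<in> K"
    "\<And>j. j < N \<Longrightarrow> a * vs ! j = (\<Sum>i<N. M' $$ (i, j) * vs ! i)"
    using M' N by (auto simp: mult_matrix_def)
  have "P * Q = 1\<^sub>m N"
  proof (rule matrix_eq_if_same_combinations[OF K us N(1)])
    fix j assume j: "j < N"
    have "(\<Sum>i<N. (P * Q) $$ (i, j) * us ! i) = us ! j"
      using linear_combination_matrix_mult[OF P(1) Q(1) j, of "\<lambda>k. us ! k"] Q(3)[OF j] P(3) by simp
    also have "\<dots> = (\<Sum>i<N. 1\<^sub>m N $$ (i, j) * us ! i)"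
      using j by (subst sum.remove[of _ j]) auto
    finally show "(\<Sum>i<N. (P * Q) $$ (i, j) * us ! i) = (\<Sum>i<N. 1\<^sub>m N $$ (i, j) * us ! i)" .
  qed (use P Q subfield_mat_mult[OF K P(1) Q(1)] subfield_fullfieldD(1,2)[OF K] in auto)
  hence "det P * det Q = 1" using det_mult[OF P(1) Q(1)] by simp
  hence "det P \<noteq> 0" by auto
  have "M * P = P * M'"
  proof (rule matrix_eq_if_same_combinations[OF K us N(1)])
    fix j assume j: "j < N"
    have "(\<Sum>i<N. (M * P) $$ (i, j) * us ! i) = (\<Sum>i<N. P $$ (i, j) * (a * us ! i))"
      using linear_combination_matrix_mult[OF M(1) P(1) j, of "\<lambda>k. us ! k"] M(3) by simp
    also have "\<dots> = a * vs ! j"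
      unfolding P(3)[OF j] sum_distrib_left by (intro sum.cong refl) (simp add: algebra_simps)
    also have "\<dots> = (\<Sum>i<N. (P * M') $$ (i, j) * us ! i)"
      using linear_combination_matrix_mult[OF P(1) M'(1) j, of "\<lambda>k. us ! k"] M'(3)[OF j] P(3) by simp
    finally show "(\<Sum>i<N. (M * P) $$ (i, j) * us ! i) = (\<Sum>i<N. (P * M') $$ (i, j) * us ! i)" .
  qed (use P M M' subfield_mat_mult[OF K P(1) M'(1)] subfield_mat_mult[OF K M(1) P(1)] in auto)
  hence "det M * det P = det P * det M'"
    using det_mult[OF M(1) P(1)] det_mult[OF P(1) M'(1)] by metis
  thus ?thesis using \<open>det P \<noteq> 0\<close> by (metis mult.commute mult_left_cancel)
qed

lemma field_norm_eq_det:
  assumes "subfield K fullfield" "field_basis K us" "mult_matrix K us a M"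
  shows "field_norm K a = det M"
proof -
  have "field_norm K a = (THE d. \<exists>us M. field_basis K us \<and> mult_matrix K us a M \<and> d = det M)"
    by (simp add: field_norm_def field_basis_def mult_matrix_def)
  also have "\<dots> = det M"
    using assms det_mult_matrix_basis_independent[OF assms(1)] by (intro the_equality) blast+
  finally show ?thesis .
qed

section \<open>Multiplicativity and Galois invariance of the norm\<close>

lemma field_norm_mult:
  assumes K: "subfield K fullfield" and us: "field_basis K us"
  shows "field_norm K (a * b) = field_norm K a * field_norm K b"
proof -
  define N where "N = length us"
  obtain A B where AB: "mult_matrix K us a A" "mult_matrix K us b B"
    using mult_matrix_exists[OF K us] by metis
  have A: "A \<in> carrier_mat N N" "\<And>i j. i < N \<Longrightarrow> j < N \<Longrightarrow> A $$ (i, j) \<in> K"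
    "\<And>j. j < N \<Longrightarrow> a * us ! j = (\<Sum>i<N. A $$ (i, j) * us ! i)"
    using AB(1) by (auto simp: mult_matrix_def N_def)
  have B: "B \<in> carrier_mat N N" "\<And>i j. i < N \<Longrightarrow> j < N \<Longrightarrow> B $$ (i, j) \<in> K"
    "\<And>j. j < N \<Longrightarrow> b * us ! j = (\<Sum>i<N. B $$ (i, j) * us ! i)"
    using AB(2) by (auto simp: mult_matrix_def N_def)
  have "a * b * us ! j = (\<Sum>i<N. (A * B) $$ (i, j) * us ! i)" if j: "j < N" for j
  proof -
    have "a * b * us ! j = (\<Sum>i<N. B $$ (i, j) * (a * us ! i))"
      unfolding mult.assoc B(3)[OF j] sum_distrib_left by (intro sum.cong refl) (simp add: algebra_simps)
    also have "\<dots> = (\<Sum>i<N. (A * B) $$ (i, j) * us ! i)"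
      using linear_combination_matrix_mult[OF A(1) B(1) j, of "\<lambda>k. us ! k"] A(3) by simp
    finally show ?thesis .
  qed
  hence "mult_matrix K us (a * b) (A * B)"
    using A(1) B(1) subfield_mat_mult[OF K A(1) B(1) A(2) B(2)] by (auto simp: mult_matrix_def N_def)
  thus ?thesis
    using field_norm_eq_det[OF K us] AB det_mult[OF A(1) B(1)] by simp
qed

lemma field_norm_one:
  assumes K: "subfield K fullfield" and us: "field_basis K us"
  shows "field_norm K 1 = 1"
proof -
  have "us ! j = (\<Sum>i<length us. 1\<^sub>m (length us) $$ (i, j) * us ! i)" if "j < length us" for j
    using that by (subst sum.remove[of _ j]) auto
  hence "mult_matrix K us 1 (1\<^sub>m (length us))"
    using subfield_fullfieldD(1,2)[OF K] by (auto simp: mult_matrix_def)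
  thus ?thesis using field_norm_eq_det[OF K us] by simp
qed

text \<open>An automorphism over K carries the basis \<open>us\<close> to another basis. There
  multiplication by \<open>\<tau> a\<close> has the very matrix of multiplication by
  \<open>a\<close> in \<open>us\<close>, because the entries lie in K and are fixed.\<close>

lemma field_norm_aut:
  assumes K: "subfield K fullfield" and us: "field_basis K us"
    and \<tau>: "\<tau> \<in> field_auts" and fixK: "\<And>k. k \<in> K \<Longrightarrow> \<tau> k = k"
  shows "field_norm K (\<tau> a) = field_norm K a"
proof -
  obtain M where M: "mult_matrix K us a M" using mult_matrix_exists[OF K us] by blast
  note D = field_autsD[OF \<tau>] field_auts_simps[OF \<tau>]
  have \<tau>sum: "\<tau> (\<Sum>i<length us. c i * us ! i) = (\<Sum>i<length us. c i * \<tau> (us ! i))"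
    if "\<And>i. i < length us \<Longrightarrow> c i \<in> K" for c
    using that by (simp add: D fixK)
  have "field_basis K (map \<tau> us)"
  proof (rule field_basisI[OF K])
    fix a
    obtain b where b: "\<tau> b = a" using bij_is_surj[OF D(4)] by (metis surjD)
    obtain c where "\<And>i. c i \<in> K" "b = (\<Sum>i<length us. c i * us ! i)"
      using field_basis_expansion[OF K us] by metis
    thus "\<exists>c. (\<forall>i. c i \<in> K) \<and> a = (\<Sum>i<length (map \<tau> us). c i * map \<tau> us ! i)"
      using b by (auto intro!: exI[of _ c] simp: D fixK)
  next
    fix c i assume c: "\<And>i. i < length (map \<tau> us) \<Longrightarrow> c i \<in> K"
      "(\<Sum>i<length (map \<tau> us). c i * map \<tau> us ! i) = 0" and i: "i < length (map \<tau> us)"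
    have "\<tau> (\<Sum>i<length us. c i * us ! i) = 0" using \<tau>sum[of c] c by simp
    hence "(\<Sum>i<length us. c i * us ! i) = 0" using D by simp
    thus "c i = 0" using field_basis_unique[OF K us, of c i] c i by simp
  qed
  moreover have "mult_matrix K (map \<tau> us) (\<tau> a) M"
    unfolding mult_matrix_def
  proof (intro conjI allI impI)
    fix j assume j: "j < length (map \<tau> us)"
    have "\<tau> a * map \<tau> us ! j = \<tau> (a * us ! j)" using j by (simp add: D)
    also have "a * us ! j = (\<Sum>i<length us. M $$ (i, j) * us ! i)"
      using M j by (auto simp: mult_matrix_def)
    also have "\<tau> \<dots> = (\<Sum>i<length (map \<tau> us). M $$ (i, j) * map \<tau> us ! i)"
      using \<tau>sum[of "\<lambda>i. M $$ (i, j)"] M j by (auto simp: mult_matrix_def)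
    finally show "\<tau> a * map \<tau> us ! j = (\<Sum>i<length (map \<tau> us). M $$ (i, j) * map \<tau> us ! i)" .
  qed (use M in \<open>auto simp: mult_matrix_def\<close>)
  ultimately show ?thesis
    using field_norm_eq_det[OF K] us M by metis
qed

lemma field_norm_nonzero:
  assumes "subfield K fullfield" "field_basis K us" "a \<noteq> 0"
  shows "field_norm K a \<noteq> 0"
  using field_norm_mult[OF assms(1,2), of a "inverse a"] field_norm_one[OF assms(1,2)] assms(3) by auto

text \<open>Taking norms removes both automorphisms, and the nonzero norms of \<open>a\<close> and
  \<open>p\<close> cancel. It is applied with \<open>w\<close> equal to \<eta> f_0.\<close>

lemma field_norm_eq_one_if_twisted_fixed_point:
  assumes K: "subfield K fullfield" and us: "field_basis K us"
    and \<rho>: "\<rho> \<in> field_auts" "\<And>k. k \<in> K \<Longrightarrow> \<rho> k = k"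
    and \<tau>: "\<tau> \<in> field_auts" "\<And>k. k \<in> K \<Longrightarrow> \<tau> k = k"
    and "a \<noteq> 0" "p \<noteq> 0" "a * p = w * \<tau> p * \<rho> a"
  shows "field_norm K w = 1"
proof -
  let ?N = "field_norm K"
  have "?N a * ?N p = ?N w * ?N p * ?N a"
    using arg_cong[OF assms(9), of ?N]
    by (simp only: field_norm_mult[OF K us] field_norm_aut[OF K us \<rho>] field_norm_aut[OF K us \<tau>])
  thus ?thesis using field_norm_nonzero[OF K us] assms(7,8) by simp
qed

section \<open>Arithmetic of skew polynomials\<close>

text \<open>The skew product is biadditive, so identities such as associativity need checking on
  monomials only.\<close>

lemma poly_monom_induct [case_names monom add]:
  assumes "\<And>a i. P (Polynomial.monom a i)" "\<And>p q. P p \<Longrightarrow> P q \<Longrightarrow> P (p + q)"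
  shows "P (p :: 'a::comm_monoid_add poly)"
proof -
  have "P (\<Sum>i\<in>I. Polynomial.monom (poly.coeff p i) i)" if "finite I" for I
    using that assms(1)[of 0 0] by (induct I) (auto intro: assms)
  hence "P (\<Sum>i\<le>Polynomial.degree p. Polynomial.monom (poly.coeff p i) i)" by simp
  thus ?thesis by (simp only: poly_as_sum_of_monoms)
qed

lemma residues_mod_iff_coeff:
  assumes "0 < Polynomial.degree f"
  shows "g \<in> residues_mod f \<longleftrightarrow> (\<forall>i\<ge>Polynomial.degree f. poly.coeff g i = 0)"
proof
  assume "g \<in> residues_mod f"
  thus "\<forall>i\<ge>Polynomial.degree f. poly.coeff g i = 0"
    by (auto simp: residues_mod_def intro: coeff_eq_0)
next
  assume "\<forall>i\<ge>Polynomial.degree f. poly.coeff g i = 0"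
  hence "\<not> Polynomial.degree f \<le> Polynomial.degree g \<or> g = 0"
    by (metis leading_coeff_0_iff)
  thus "g \<in> residues_mod f" by (auto simp: residues_mod_def)
qed

lemma residues_mod_closed:
  assumes "g \<in> residues_mod f" "h \<in> residues_mod f"
  shows "g + h \<in> residues_mod f" "g - h \<in> residues_mod f"
  using assms degree_add_le_max[of g h] degree_diff_le_max[of g h]
  by (auto simp: residues_mod_def)

lemma residues_mod_smult: "g \<in> residues_mod f \<Longrightarrow> Polynomial.smult c g \<in> residues_mod f"
  using degree_smult_le[of c g] by (auto simp: residues_mod_def)

lemma zero_in_residues_mod [simp]: "0 \<in> residues_mod f"
  by (simp add: residues_mod_def)

locale skew_polynomials =
  fixes \<sigma> :: "'a::field \<Rightarrow> 'a"
  assumes aut: "\<sigma> \<in> field_auts"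
begin

abbreviation smul :: "'a poly \<Rightarrow> 'a poly \<Rightarrow> 'a poly" (infixl \<open>\<odot>\<close> 70)
  where "p \<odot> q \<equiv> skew_mult \<sigma> p q"

abbreviation R :: "'a poly ring"
  where "R \<equiv> skew_poly_ring \<sigma>"

lemmas aut_simps [simp] = field_autsD(1-3)[OF aut] field_auts_simps[OF aut]
lemmas pow_simps [simp] =
  field_autsD(1-3)[OF field_auts_funpow[OF aut]] field_auts_simps[OF field_auts_funpow[OF aut]]

text \<open>The summation range no longer involves the degrees of the factors, so additivity in each
  factor can be read off coefficientwise.\<close>

lemma coeff_skew_mult:
  "poly.coeff (p \<odot> q) k = (\<Sum>i\<le>k. poly.coeff p i * (\<sigma> ^^ i) (poly.coeff q (k - i)))"
proof -
  have inner: "(\<Sum>j\<le>Polynomial.degree q. poly.coeff (Polynomial.monom (poly.coeff p i * (\<sigma> ^^ i) (poly.coeff q j)) (i + j)) k)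
    = (if i \<le> k then poly.coeff p i * (\<sigma> ^^ i) (poly.coeff q (k - i)) else 0)" for i
  proof (cases "i \<le> k")
    case True
    have "(\<Sum>j\<le>Polynomial.degree q. poly.coeff (Polynomial.monom (poly.coeff p i * (\<sigma> ^^ i) (poly.coeff q j)) (i + j)) k)
      = (\<Sum>j\<le>Polynomial.degree q. if j = k - i then poly.coeff p i * (\<sigma> ^^ i) (poly.coeff q (k - i)) else 0)"
      using True by (intro sum.cong) auto
    thus ?thesis using True by (simp add: sum.delta) (auto simp: coeff_eq_0)
  qed auto
  have "poly.coeff (p \<odot> q) k = (\<Sum>i\<le>Polynomial.degree p. if i \<le> k then poly.coeff p i * (\<sigma> ^^ i) (poly.coeff q (k - i)) else 0)"
    unfolding skew_mult_def coeff_sum inner ..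
  also have "\<dots> = (\<Sum>i\<in>{..Polynomial.degree p} \<inter> {..k}. poly.coeff p i * (\<sigma> ^^ i) (poly.coeff q (k - i)))"
    by (subst sum.inter_restrict) auto
  also have "\<dots> = (\<Sum>i\<le>k. poly.coeff p i * (\<sigma> ^^ i) (poly.coeff q (k - i)))"
    by (rule sum.mono_neutral_left) (auto simp: coeff_eq_0 not_le)
  finally show ?thesis .
qed

lemma add_smul: "(p + q) \<odot> r = p \<odot> r + q \<odot> r"
  by (rule poly_eqI) (simp add: coeff_skew_mult algebra_simps sum.distrib)

lemma smul_add: "r \<odot> (p + q) = r \<odot> p + r \<odot> q"
  by (rule poly_eqI) (simp add: coeff_skew_mult algebra_simps sum.distrib)

lemma zero_smul [simp]: "0 \<odot> p = 0" and smul_zero [simp]: "p \<odot> 0 = 0"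
  by (rule poly_eqI, simp add: coeff_skew_mult)+

lemma diff_smul: "(p - q) \<odot> r = p \<odot> r - q \<odot> r"
  by (metis add_smul add_diff_cancel diff_add_cancel)

lemma smul_diff: "r \<odot> (p - q) = r \<odot> p - r \<odot> q"
  by (metis smul_add add_diff_cancel diff_add_cancel)

lemma uminus_smul: "(- p) \<odot> r = - (p \<odot> r)"
  using diff_smul[of 0 p r] by simp

lemma sum_smul: "sum g I \<odot> r = (\<Sum>i\<in>I. g i \<odot> r)"
  by (induct I rule: infinite_finite_induct) (auto simp: add_smul)

lemma monom_smul_monom:
  "Polynomial.monom a i \<odot> Polynomial.monom b j = Polynomial.monom (a * (\<sigma> ^^ i) b) (i + j)"
proof (rule poly_eqI)
  fix k
  have "poly.coeff (Polynomial.monom a i \<odot> Polynomial.monom b j) k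
    = (\<Sum>x\<le>k. if x = i then (if i + j = k then a * (\<sigma> ^^ i) b else 0) else 0)"
    unfolding coeff_skew_mult by (intro sum.cong refl) auto
  also have "\<dots> = poly.coeff (Polynomial.monom (a * (\<sigma> ^^ i) b) (i + j)) k"
    by (subst sum.delta) auto
  finally show "poly.coeff (Polynomial.monom a i \<odot> Polynomial.monom b j) k
    = poly.coeff (Polynomial.monom (a * (\<sigma> ^^ i) b) (i + j)) k" .
qed

lemma smul_assoc: "p \<odot> q \<odot> r = p \<odot> (q \<odot> r)"
proof (induct p rule: poly_monom_induct)
  case (monom a i)
  show ?case
  proof (induct q rule: poly_monom_induct)
    case (monom b j)
    show ?case
    proof (induct r rule: poly_monom_induct)
      case (monom c k)
      show ?case by (simp add: monom_smul_monom funpow_add algebra_simps)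
    qed (simp add: smul_add)
  qed (simp add: smul_add add_smul)
qed (simp add: add_smul)

lemma const_smul [simp]: "[:c:] \<odot> p = Polynomial.smult c p"
proof -
  have "Polynomial.monom c 0 \<odot> p = Polynomial.smult c p"
    by (induct p rule: poly_monom_induct)
      (simp_all add: smul_add smult_add_right monom_smul_monom smult_monom del: monom_0)
  thus ?thesis by (simp add: monom_0)
qed

lemma one_smul [simp]: "1 \<odot> p = p"
  using const_smul[of 1 p] by (simp add: one_pCons)

lemma smul_one [simp]: "p \<odot> 1 = p"
proof (induct p rule: poly_monom_induct)
  case (monom a i)
  show ?case using monom_smul_monom[of a i 1 0] by simp
qed (simp add: add_smul)

lemma smult_smul: "Polynomial.smult c p \<odot> q = Polynomial.smult c (p \<odot> q)"
  by (metis const_smul smul_assoc)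

lemma smul_const_fixed:
  assumes "\<sigma> c = c"
  shows "p \<odot> [:c:] = Polynomial.smult c p"
proof -
  have "(\<sigma> ^^ i) c = c" for i by (induct i) (auto simp: assms)
  hence "p \<odot> Polynomial.monom c 0 = Polynomial.smult c p"
    by (induct p rule: poly_monom_induct)
      (simp_all add: add_smul smult_add_right monom_smul_monom smult_monom mult.commute del: monom_0)
  thus ?thesis by (simp add: monom_0)
qed

lemma smul_smult_fixed: "\<sigma> c = c \<Longrightarrow> p \<odot> Polynomial.smult c q = Polynomial.smult c (p \<odot> q)"
  by (metis const_smul smul_const_fixed smul_assoc smult_smul)

text \<open>Only the product of the two leading terms reaches this exponent. As \<sigma> is
  injective, the coefficient is nonzero for nonzero factors, so degrees add and R has no zero
  divisors.\<close>

lemma coeff_skew_mult_top: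
  "poly.coeff (p \<odot> q) (Polynomial.degree p + Polynomial.degree q)
    = lead_coeff p * (\<sigma> ^^ Polynomial.degree p) (lead_coeff q)"
proof -
  have "poly.coeff (p \<odot> q) (Polynomial.degree p + Polynomial.degree q)
    = (\<Sum>i\<le>Polynomial.degree p + Polynomial.degree q. if i = Polynomial.degree p then lead_coeff p * (\<sigma> ^^ Polynomial.degree p) (lead_coeff q) else 0)"
    unfolding coeff_skew_mult
  proof (intro sum.cong refl)
    fix i assume "i \<in> {..Polynomial.degree p + Polynomial.degree q}"
    thus "poly.coeff p i * (\<sigma> ^^ i) (poly.coeff q (Polynomial.degree p + Polynomial.degree q - i)) =
      (if i = Polynomial.degree p then lead_coeff p * (\<sigma> ^^ Polynomial.degree p) (lead_coeff q) else 0)"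
      by (cases i "Polynomial.degree p" rule: linorder_cases) (auto simp: coeff_eq_0)
  qed
  thus ?thesis by simp
qed

lemma degree_skew_mult_le: "Polynomial.degree (p \<odot> q) \<le> Polynomial.degree p + Polynomial.degree q"
proof (rule degree_le, intro allI impI)
  fix k assume k: "Polynomial.degree p + Polynomial.degree q < k"
  show "poly.coeff (p \<odot> q) k = 0"
    unfolding coeff_skew_mult
  proof (intro sum.neutral ballI)
    fix i assume "i \<in> {..k}"
    thus "poly.coeff p i * (\<sigma> ^^ i) (poly.coeff q (k - i)) = 0"
      using k by (cases "i \<le> Polynomial.degree p") (auto simp: coeff_eq_0)
  qed
qed

lemma degree_skew_mult:
  assumes "p \<noteq> 0" "q \<noteq> 0"
  shows "Polynomial.degree (p \<odot> q) = Polynomial.degree p + Polynomial.degree q"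
  using degree_skew_mult_le[of p q] coeff_skew_mult_top[of p q] assms
  by (intro antisym le_degree) auto

lemma skew_mult_eq_0_iff [simp]: "p \<odot> q = 0 \<longleftrightarrow> p = 0 \<or> q = 0"
  using coeff_skew_mult_top[of p q] by auto

lemma smul_left_cancel: "p \<noteq> 0 \<Longrightarrow> p \<odot> q = p \<odot> r \<Longrightarrow> q = r"
  using smul_diff[of p q r] by auto

lemma smul_right_cancel: "p \<noteq> 0 \<Longrightarrow> q \<odot> p = r \<odot> p \<Longrightarrow> q = r"
  using diff_smul[of q r p] by auto

lemma R_simps [simp]:
  "carrier R = UNIV" "p \<otimes>\<^bsub>R\<^esub> q = p \<odot> q" "p \<oplus>\<^bsub>R\<^esub> q = p + q" "\<one>\<^bsub>R\<^esub> = 1" "\<zero>\<^bsub>R\<^esub> = 0"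
  by (simp_all add: skew_poly_ring_def)

lemma ring_R: "ring R"
proof -
  have "\<exists>y. x + y = 0" for x :: "'a poly" by (rule exI[of _ "- x"]) simp
  thus ?thesis
    by unfold_locales (auto simp: Units_def smul_assoc add_smul smul_add algebra_simps)
qed

lemma degree_0_if_in_Units:
  assumes "p \<in> Units R"
  shows "Polynomial.degree p = 0"
proof -
  obtain q where "p \<odot> q = 1" using assms by (auto simp: Units_def)
  thus ?thesis using degree_skew_mult[of p q] by (metis add_is_0 degree_1 skew_mult_eq_0_iff zero_neq_one)
qed

lemma const_in_Units: "c \<noteq> 0 \<Longrightarrow> [:c:] \<in> Units R"
  by (auto simp: Units_def one_pCons intro!: exI[of _ "[:inverse c:]"])

lemma degree_0_cases:
  assumes "Polynomial.degree p = 0" "p \<noteq> (0 :: 'a poly)"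
  obtains c where "c \<noteq> 0" "p = [:c:]"
  using assms degree_eq_zeroE by (metis pCons_0_0)

lemma nc_irreducibleD:
  assumes "nc_irreducible R f"
  shows "f \<noteq> 0" "0 < Polynomial.degree f"
    "\<And>a b. f = a \<odot> b \<Longrightarrow> Polynomial.degree a = 0 \<or> Polynomial.degree b = 0"
proof -
  show "f \<noteq> 0" using assms by (simp add: nc_irreducible_def)
  thus "0 < Polynomial.degree f"
    using assms const_in_Units degree_0_cases[of f] by (metis gr0I nc_irreducible_def)
  show "\<And>a b. f = a \<odot> b \<Longrightarrow> Polynomial.degree a = 0 \<or> Polynomial.degree b = 0"
    using assms degree_0_if_in_Units unfolding nc_irreducible_def by fastforce
qed

subsection \<open>Right division\<close>

definition rdvd :: "'a poly \<Rightarrow> 'a poly \<Rightarrow> bool"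
  where "rdvd f g \<longleftrightarrow> (\<exists>q. g = q \<odot> f)"

lemma PIdl_iff_rdvd: "g \<in> PIdl\<^bsub>R\<^esub> f \<longleftrightarrow> rdvd f g"
  by (auto simp: cgenideal_def rdvd_def)

lemma rdvd_add: "rdvd f g \<Longrightarrow> rdvd f h \<Longrightarrow> rdvd f (g + h)"
  unfolding rdvd_def by (metis add_smul)

lemma rdvd_diff: "rdvd f g \<Longrightarrow> rdvd f h \<Longrightarrow> rdvd f (g - h)"
  unfolding rdvd_def by (metis diff_smul)

lemma rdvd_smul: "rdvd f g \<Longrightarrow> rdvd f (h \<odot> g)"
  unfolding rdvd_def by (metis smul_assoc)

lemma rdvd_self_smul [simp]: "rdvd f (h \<odot> f)" "rdvd f f"
  unfolding rdvd_def by (auto intro: exI[of _ 1])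

lemma rdvd_smult: "rdvd f g \<Longrightarrow> rdvd f (Polynomial.smult c g)"
  using rdvd_smul[of f g "[:c:]"] by simp

lemma rdvd_zero [simp]: "rdvd f 0"
  using rdvd_self_smul(1)[of f 0] by simp

lemma rdvd_sum: "(\<And>i. i \<in> I \<Longrightarrow> rdvd f (g i)) \<Longrightarrow> rdvd f (sum g I)"
  by (induct I rule: infinite_finite_induct) (auto intro: rdvd_add)

lemma rdvd_trans: "rdvd f g \<Longrightarrow> rdvd g h \<Longrightarrow> rdvd f h"
  unfolding rdvd_def by (metis smul_assoc)

lemma rdvd_residue_eq_0:
  assumes "rdvd f g" "g \<in> residues_mod f"
  shows "g = 0"
proof (rule ccontr)
  assume "g \<noteq> 0"
  obtain q where q: "g = q \<odot> f" using assms(1) by (auto simp: rdvd_def)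
  hence "q \<noteq> 0" "f \<noteq> 0" using \<open>g \<noteq> 0\<close> by auto
  hence "Polynomial.degree f \<le> Polynomial.degree g" using degree_skew_mult q by simp
  thus False using assms(2) \<open>g \<noteq> 0\<close> by (simp add: residues_mod_def)
qed

lemma right_division:
  assumes "f \<noteq> 0"
  shows "\<exists>q. \<exists>r\<in>residues_mod f. g = q \<odot> f + r"
proof (induct "Polynomial.degree g" arbitrary: g rule: less_induct)
  case less
  show ?case
  proof (cases "g \<in> residues_mod f")
    case True
    thus ?thesis by (metis add_0 zero_smul)
  next
    case False
    hence g: "g \<noteq> 0" "Polynomial.degree f \<le> Polynomial.degree g" by (auto simp: residues_mod_def)
    define k where "k = Polynomial.degree g - Polynomial.degree f"
    \<comment> \<open>Moving the leading coefficient of f past x^k applies \<sigma>^k to it, and the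
      denominator compensates for this.\<close>
    define t where "t = Polynomial.monom (lead_coeff g / (\<sigma> ^^ k) (lead_coeff f)) k"
    have lf: "(\<sigma> ^^ k) (lead_coeff f) \<noteq> 0" using assms by simp
    hence t: "t \<noteq> 0" "Polynomial.degree t = k" "lead_coeff t = lead_coeff g / (\<sigma> ^^ k) (lead_coeff f)"
      using g(1) by (auto simp: t_def monom_eq_0_iff degree_monom_eq)
    have deg: "Polynomial.degree (t \<odot> f) = Polynomial.degree g"
      using degree_skew_mult[OF t(1) assms] t(2) g(2) by (simp add: k_def)
    have "poly.coeff (t \<odot> f) (Polynomial.degree g) = lead_coeff g"
      using coeff_skew_mult_top[of t f] t lf g(2) by (simp add: k_def)
    hence lead: "poly.coeff (g - t \<odot> f) (Polynomial.degree g) = 0" by simp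
    have ex: "\<exists>q. \<exists>r\<in>residues_mod f. g - t \<odot> f = q \<odot> f + r"
    proof (cases "g - t \<odot> f = 0")
      case True
      thus ?thesis by (intro exI[of _ 0] bexI[of _ 0]) auto
    next
      case False
      have "Polynomial.degree (g - t \<odot> f) \<le> Polynomial.degree g"
        using degree_diff_le_max[of g "t \<odot> f"] deg by simp
      moreover have "Polynomial.degree (g - t \<odot> f) \<noteq> Polynomial.degree g"
        using lead False leading_coeff_0_iff by metis
      ultimately show ?thesis by (intro less) simp
    qed
    then obtain q r where "r \<in> residues_mod f" "g - t \<odot> f = q \<odot> f + r" by blast
    hence "g = (t + q) \<odot> f + r" by (simp add: add_smul algebra_simps)
    thus ?thesis using \<open>r \<in> residues_mod f\<close> by blast
  qed
qed

lemma skew_mod_eqI: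
  assumes "r \<in> residues_mod f" "rdvd f (g - r)"
  shows "skew_mod \<sigma> g f = r"
  unfolding skew_mod_def
proof (rule the_equality)
  show "(r = 0 \<or> Polynomial.degree r < Polynomial.degree f) \<and> (\<exists>q. g = q \<odot> f + r)"
    using assms by (auto simp: residues_mod_def rdvd_def algebra_simps)
  fix r' assume "(r' = 0 \<or> Polynomial.degree r' < Polynomial.degree f) \<and> (\<exists>q. g = q \<odot> f + r')"
  hence r': "r' \<in> residues_mod f" "rdvd f (g - r')" by (auto simp: residues_mod_def)
  have "rdvd f ((g - r) - (g - r'))" using rdvd_diff[OF assms(2) r'(2)] .
  hence "r' - r = 0" using r'(1) assms(1) by (intro rdvd_residue_eq_0[of f]) (auto intro: residues_mod_closed)
  thus "r' = r" by simp
qed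

lemma skew_mod:
  assumes "f \<noteq> 0"
  shows "skew_mod \<sigma> g f \<in> residues_mod f" "rdvd f (g - skew_mod \<sigma> g f)"
proof -
  obtain q r where qr: "r \<in> residues_mod f" "g = q \<odot> f + r" using right_division[OF assms] by blast
  hence "rdvd f (g - r)" by simp
  from skew_mod_eqI[OF qr(1) this] qr(1) this
  show "skew_mod \<sigma> g f \<in> residues_mod f" "rdvd f (g - skew_mod \<sigma> g f)" by auto
qed

lemma skew_mod_cong:
  assumes "f \<noteq> 0" "rdvd f (g - h)"
  shows "skew_mod \<sigma> g f = skew_mod \<sigma> h f"
  using rdvd_add[OF assms(2) skew_mod(2)[OF assms(1), of h]]
  by (intro skew_mod_eqI skew_mod assms) simp

lemma skew_mod_eq_0_iff: "f \<noteq> 0 \<Longrightarrow> skew_mod \<sigma> g f = 0 \<longleftrightarrow> rdvd f g"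
  using skew_mod(2)[of f g] skew_mod_eqI[of 0 f g] by auto

lemma skew_mod_residue: "g \<in> residues_mod f \<Longrightarrow> skew_mod \<sigma> g f = g"
  by (rule skew_mod_eqI) auto

lemma skew_mod_add:
  assumes "f \<noteq> 0"
  shows "skew_mod \<sigma> (g + h) f = skew_mod \<sigma> g f + skew_mod \<sigma> h f"
  using rdvd_add[OF skew_mod(2)[OF assms, of g] skew_mod(2)[OF assms, of h]]
  by (intro skew_mod_eqI residues_mod_closed(1) skew_mod assms) (simp add: algebra_simps)

lemma skew_mod_smult:
  assumes "f \<noteq> 0"
  shows "skew_mod \<sigma> (Polynomial.smult c g) f = Polynomial.smult c (skew_mod \<sigma> g f)"
  using rdvd_smult[OF skew_mod(2)[OF assms, of g], of c]
  by (intro skew_mod_eqI residues_mod_smult skew_mod assms) (simp add: smult_diff_right)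

text \<open>Rf is a left ideal, so the right-hand factor of a product may be reduced first. The
  corresponding rule for the left-hand factor fails in general.\<close>

lemma skew_mod_smul_skew_mod:
  assumes "f \<noteq> 0"
  shows "skew_mod \<sigma> (g \<odot> skew_mod \<sigma> h f) f = skew_mod \<sigma> (g \<odot> h) f"
proof (rule skew_mod_cong[OF assms])
  have "rdvd f (g \<odot> (h - skew_mod \<sigma> h f))" by (intro rdvd_smul skew_mod assms)
  hence "rdvd f (0 - g \<odot> (h - skew_mod \<sigma> h f))" by (intro rdvd_diff) auto
  thus "rdvd f (g \<odot> skew_mod \<sigma> h f - g \<odot> h)" by (simp add: smul_diff)
qed

section \<open>Common right divisors and annihilators in R/Rf\<close>

lemma right_bezout:
  assumes "g \<noteq> 0 \<or> h \<noteq> 0"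
  shows "\<exists>d u v. d \<noteq> 0 \<and> d = u \<odot> g + v \<odot> h \<and> rdvd d g \<and> rdvd d h"
proof -
  define S where "S = {w. w \<noteq> 0 \<and> (\<exists>u v. w = u \<odot> g + v \<odot> h)}"
  have gh: "g = 1 \<odot> g + 0 \<odot> h" "h = 0 \<odot> g + 1 \<odot> h" by simp_all
  have gS: "g \<in> S" if "g \<noteq> 0" using that gh(1) unfolding S_def by blast
  have hS: "h \<in> S" if "h \<noteq> 0" using that gh(2) unfolding S_def by blast
  have "\<exists>w. w \<in> S" using assms gS hS by auto
  \<comment> \<open>An element of least degree in Rg + Rh. The remainder of any other element modulo
    \<open>d\<close> stays in this left ideal and has smaller degree, hence is zero.\<close>
  then obtain d where d: "d \<in> S" "\<And>w. w \<in> S \<Longrightarrow> Polynomial.degree d \<le> Polynomial.degree w"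
    using arg_min_nat_lemma[of "\<lambda>w. w \<in> S" _ Polynomial.degree] by metis
  have d0: "d \<noteq> 0" using d(1) by (simp add: S_def)
  obtain u v where uv: "d = u \<odot> g + v \<odot> h" using d(1) unfolding S_def by blast
  have div: "rdvd d w" if w: "w \<in> S" for w
  proof -
    obtain q r where qr: "r \<in> residues_mod d" "w = q \<odot> d + r" using right_division[OF d0] by blast
    obtain u' v' where uv': "w = u' \<odot> g + v' \<odot> h" using w unfolding S_def by blast
    have "r = (u' - q \<odot> u) \<odot> g + (v' - q \<odot> v) \<odot> h"
    proof -
      have "r = w - q \<odot> d" using qr(2) by simp
      thus ?thesis unfolding uv' by (subst (asm) uv) (simp add: diff_smul smul_add smul_assoc)
    qed
    hence "r \<noteq> 0 \<Longrightarrow> r \<in> S" unfolding S_def by blast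
    hence "r \<noteq> 0 \<Longrightarrow> Polynomial.degree d \<le> Polynomial.degree r" using d(2) by blast
    hence "r = 0" using qr(1) unfolding residues_mod_def by force
    thus ?thesis using qr(2) by simp
  qed
  have "rdvd d g" using div gS by (cases "g = 0") auto
  moreover have "rdvd d h" using div hS by (cases "h = 0") auto
  ultimately show ?thesis using d0 uv by blast
qed

lemma rdvd_if_degree_0:
  assumes "Polynomial.degree d = 0" "d \<noteq> 0" "rdvd f (d \<odot> b)"
  shows "rdvd f b"
proof -
  obtain c where c: "c \<noteq> 0" "d = [:c:]" using degree_0_cases assms(1,2) by blast
  thus ?thesis using rdvd_smult[OF assms(3), of "inverse c"] by simp
qed

text \<open>This is maximality of the left ideal Rf. A greatest common right divisor of b and f has
  a cofactor in f. If the cofactor were constant, f would divide b; so the divisor itself is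
  constant and can be scaled to 1.\<close>

lemma irreducible_comaximal:
  assumes f: "nc_irreducible R f" and b: "\<not> rdvd f b"
  shows "\<exists>u v. 1 = u \<odot> b + v \<odot> f"
proof -
  note fD = nc_irreducibleD[OF f]
  obtain d u v where d: "d \<noteq> 0" "d = u \<odot> b + v \<odot> f" "rdvd d b" "rdvd d f"
    using right_bezout[of b f] fD(1) by blast
  obtain a where a: "f = a \<odot> d" using d(4) by (auto simp: rdvd_def)
  have "Polynomial.degree a \<noteq> 0"
  proof
    assume "Polynomial.degree a = 0"
    hence "rdvd f d" using rdvd_if_degree_0[of a f d] a fD(1) rdvd_self_smul(2)[of f] by auto
    thus False using b rdvd_trans d(3) by blast
  qed
  hence "Polynomial.degree d = 0" using fD(3)[OF a] by simp
  then obtain c where c: "c \<noteq> 0" "d = [:c:]" using degree_0_cases d(1) by blast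
  have "1 = Polynomial.smult (inverse c) (u \<odot> b + v \<odot> f)"
    using c d(2) by (metis left_inverse one_pCons smult_0_right smult_pCons)
  thus ?thesis by (metis smult_add_right smult_smul)
qed

text \<open>The images of the powers of \<open>x\<close> below \<open>deg g\<close> under right multiplication by \<open>b\<close>
  span the simple module \<open>R/Rf\<close> over L.\<close>

lemma annihilator_degree_ge:
  assumes f: "nc_irreducible R f" and b: "\<not> rdvd f b" and g: "g \<noteq> 0" "rdvd f (g \<odot> b)"
  shows "Polynomial.degree f \<le> Polynomial.degree g"
proof (rule ccontr)
  assume lt: "\<not> ?thesis"
  define e where "e = Polynomial.degree f"
  obtain u v where uv: "1 = u \<odot> b + v \<odot> f" using irreducible_comaximal[OF f b] by blast
  \<comment> \<open>The class of b generates R/Rf, so x^j is a multiple of b modulo f. The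
    multiplier can be reduced modulo g because g annihilates b.\<close>
  have "\<exists>r\<in>residues_mod g. rdvd f (Polynomial.monom 1 j - r \<odot> b)" for j
  proof -
    obtain q r where qr: "r \<in> residues_mod g" "Polynomial.monom 1 j \<odot> u = q \<odot> g + r"
      using right_division[OF g(1)] by blast
    have "Polynomial.monom 1 j = Polynomial.monom 1 j \<odot> (u \<odot> b + v \<odot> f)" by (simp flip: uv)
    also have "\<dots> = (q \<odot> g + r) \<odot> b + (Polynomial.monom 1 j \<odot> v) \<odot> f"
      by (simp add: smul_add smul_assoc flip: qr(2))
    finally have "Polynomial.monom 1 j - r \<odot> b = q \<odot> (g \<odot> b) + (Polynomial.monom 1 j \<odot> v) \<odot> f"
      by (simp add: add_smul smul_assoc algebra_simps)
    hence "rdvd f (Polynomial.monom 1 j - r \<odot> b)" by (simp add: rdvd_add rdvd_smul g(2))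
    thus ?thesis using qr(1) by blast
  qed
  then obtain r where r: "\<And>j. r j \<in> residues_mod g" "\<And>j. rdvd f (Polynomial.monom 1 j - r j \<odot> b)"
    by metis
  \<comment> \<open>If deg g < e, the e multipliers \<open>r j\<close> are linearly dependent over
    L. The same combination of the x^j is then a polynomial of degree below e divisible by f,
    although its coefficients \<open>w\<close> are not all zero.\<close>
  obtain w where w: "\<exists>j<e. w j \<noteq> 0" "\<And>i. i < Polynomial.degree g \<Longrightarrow> (\<Sum>j<e. poly.coeff (r j) i * w j) = 0"
    using wide_system_has_nontrivial_solution[of "Polynomial.degree g" e "\<lambda>i j. poly.coeff (r j) i"] lt
    by (auto simp: e_def)
  have rg0: "poly.coeff (r j) i = 0" if "Polynomial.degree g \<le> i" for i j
    using r(1)[of j] that by (auto simp: residues_mod_def coeff_eq_0)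
  have "(\<Sum>j<e. Polynomial.smult (w j) (r j)) = 0"
  proof (rule poly_eqI)
    fix i
    show "poly.coeff (\<Sum>j<e. Polynomial.smult (w j) (r j)) i = poly.coeff 0 i"
      using w(2)[of i] rg0[of i] by (cases "i < Polynomial.degree g") (auto simp: coeff_sum mult.commute)
  qed
  moreover have "rdvd f (\<Sum>j<e. Polynomial.smult (w j) (Polynomial.monom 1 j - r j \<odot> b))"
    by (intro rdvd_sum rdvd_smult r)
  moreover have "(\<Sum>j<e. Polynomial.smult (w j) (Polynomial.monom 1 j - r j \<odot> b))
    = (\<Sum>j<e. Polynomial.monom (w j) j) - (\<Sum>j<e. Polynomial.smult (w j) (r j)) \<odot> b"
    by (simp add: smult_diff_right sum_subtractf sum_smul smult_smul smult_monom)
  ultimately have "rdvd f (\<Sum>j<e. Polynomial.monom (w j) j)" by simp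
  moreover have "(\<Sum>j<e. Polynomial.monom (w j) j) \<in> residues_mod f"
    using nc_irreducibleD(2)[OF f] by (auto simp: residues_mod_iff_coeff coeff_sum e_def)
  ultimately have 0: "(\<Sum>j<e. Polynomial.monom (w j) j) = 0" by (rule rdvd_residue_eq_0)
  have "w j = 0" if "j < e" for j
    using arg_cong[OF 0, of "\<lambda>p. poly.coeff p j"] that by (simp add: coeff_sum)
  thus False using w(1) by blast
qed

text \<open>The e + 1 classes of x^j b with j \<le> e lie in the e-dimensional L-space R/Rf. A
  dependence among them provides the coefficients of \<open>g\<close>.\<close>

lemma annihilator_of_small_degree:
  assumes "0 < Polynomial.degree f"
  shows "\<exists>g. g \<noteq> 0 \<and> Polynomial.degree g \<le> Polynomial.degree f \<and> rdvd f (g \<odot> b)"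
proof -
  define e where "e = Polynomial.degree f"
  have f0: "f \<noteq> 0" using assms by auto
  define r where "r j = skew_mod \<sigma> (Polynomial.monom 1 j \<odot> b) f" for j
  obtain w where w: "\<exists>j<Suc e. w j \<noteq> 0" "\<And>i. i < e \<Longrightarrow> (\<Sum>j<Suc e. poly.coeff (r j) i * w j) = 0"
    using wide_system_has_nontrivial_solution[of e "Suc e" "\<lambda>i j. poly.coeff (r j) i"] by auto
  define g where "g = (\<Sum>j<Suc e. Polynomial.monom (w j) j)"
  have coeff: "poly.coeff g j = (if j < Suc e then w j else 0)" for j
    by (simp add: g_def coeff_sum del: sum.lessThan_Suc)
  have "g \<noteq> 0" using w(1) coeff by (metis coeff_0)
  moreover have "Polynomial.degree g \<le> e" by (rule degree_le) (simp add: coeff)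
  moreover have "rdvd f (g \<odot> b)"
  proof -
    have "(\<Sum>j<Suc e. Polynomial.smult (w j) (r j)) = 0"
    proof (rule poly_eqI)
      fix i
      have "poly.coeff (r j) i = 0" if "e \<le> i" for j
        using that skew_mod(1)[OF f0] residues_mod_iff_coeff[OF assms] by (simp add: r_def e_def)
      thus "poly.coeff (\<Sum>j<Suc e. Polynomial.smult (w j) (r j)) i = poly.coeff 0 i"
        using w(2)[of i] by (cases "i < e") (auto simp: coeff_sum mult.commute simp del: sum.lessThan_Suc)
    qed
    moreover have "rdvd f (\<Sum>j<Suc e. Polynomial.smult (w j) (Polynomial.monom 1 j \<odot> b - r j))"
      unfolding r_def by (intro rdvd_sum rdvd_smult skew_mod f0)
    moreover have "(\<Sum>j<Suc e. Polynomial.smult (w j) (Polynomial.monom 1 j \<odot> b - r j))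
      = g \<odot> b - (\<Sum>j<Suc e. Polynomial.smult (w j) (r j))"
      by (simp add: g_def smult_diff_right sum_subtractf sum_smul smult_monom flip: smult_smul del: sum.lessThan_Suc)
    ultimately show ?thesis by simp
  qed
  ultimately show ?thesis unfolding e_def by blast
qed

text \<open>One inequality is \<open>annihilator_degree_ge\<close>. For the other, p and an
  annihilator \<open>g\<close> of b of degree at most deg f have a greatest common right divisor
  that still annihilates b. It is not constant, so by irreducibility it has the degree of p, and it
  divides \<open>g\<close>.\<close>

lemma similar_irreducible_degree:
  assumes f: "nc_irreducible R f" and p: "nc_irreducible R p"
    and b: "\<not> rdvd f b" "rdvd f (p \<odot> b)"
  shows "Polynomial.degree p = Polynomial.degree f"
proof (rule antisym)
  show "Polynomial.degree f \<le> Polynomial.degree p"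
    using annihilator_degree_ge[OF f b(1) _ b(2)] nc_irreducibleD(1)[OF p] .
  obtain g where g: "g \<noteq> 0" "Polynomial.degree g \<le> Polynomial.degree f" "rdvd f (g \<odot> b)"
    using annihilator_of_small_degree[OF nc_irreducibleD(2)[OF f]] by blast
  obtain d u v where d: "d \<noteq> 0" "d = u \<odot> p + v \<odot> g" "rdvd d p" "rdvd d g"
    using right_bezout[of p g] g(1) by blast
  have "d \<odot> b = u \<odot> (p \<odot> b) + v \<odot> (g \<odot> b)"
    by (subst d(2)) (simp add: add_smul smul_assoc)
  hence "rdvd f (d \<odot> b)" using b(2) g(3) by (simp add: rdvd_add rdvd_smul)
  hence "Polynomial.degree d \<noteq> 0" using rdvd_if_degree_0[OF _ d(1)] b(1) by blast
  moreover obtain a where a: "p = a \<odot> d" using d(3) by (auto simp: rdvd_def)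
  ultimately have "Polynomial.degree a = 0" using nc_irreducibleD(3)[OF p a] by simp
  moreover obtain a' where a': "g = a' \<odot> d" using d(4) by (auto simp: rdvd_def)
  moreover have "a \<noteq> 0" "a' \<noteq> 0" using a a' g(1) nc_irreducibleD(1)[OF p] by auto
  ultimately show "Polynomial.degree p \<le> Polynomial.degree f"
    using degree_skew_mult[OF _ d(1), of a] degree_skew_mult[OF _ d(1), of a'] a a' g(2) by simp
qed

subsection \<open>Constant coefficients of similar elements\<close>

text \<open>The matrix of left multiplication by \<open>x\<close>, a \<open>\<sigma>\<close>-semilinear map, on \<open>R/Rf\<close> in the
  basis of powers of \<open>x\<close>.\<close>

definition companion :: "'a poly \<Rightarrow> 'a mat"
  where "companion f = mat (Polynomial.degree f) (Polynomial.degree f)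
    (\<lambda>(i, j). if Suc i < Polynomial.degree f then (if j = Suc i then 1 else 0) else - poly.coeff f j)"

lemma det_companion:
  assumes "0 < Polynomial.degree f"
  shows "det (companion f) = (- 1) ^ Polynomial.degree f * poly.coeff f 0"
proof -
  obtain N where N: "Polynomial.degree f = Suc N" using assms gr0_implies_Suc by blast
  have C: "companion f \<in> carrier_mat (Suc N) (Suc N)" by (simp add: companion_def N)
  \<comment> \<open>Column 0 has its only possibly nonzero entry in the last row, so the expansion
    involves this minor alone.\<close>
  have del: "mat_delete (companion f) N 0 = 1\<^sub>m N"
    by (rule eq_matI) (auto simp: mat_delete_def companion_def N)
  have "det (companion f) = (\<Sum>i<Suc N. companion f $$ (i, 0) * cofactor (companion f) i 0)"
    by (rule laplace_expansion_column[OF C]) simp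
  also have "\<dots> = companion f $$ (N, 0) * cofactor (companion f) N 0"
    by (simp add: companion_def N)
  also have "cofactor (companion f) N 0 = (- 1) ^ N"
    by (simp add: cofactor_def del)
  also have "companion f $$ (N, 0) * (- 1) ^ N = (- 1) ^ Suc N * poly.coeff f 0"
    by (simp add: companion_def N)
  finally show ?thesis by (simp add: N)
qed

text \<open>The product x r has degree at most deg f, so one left multiple of the monic f completes
  the reduction. The right side is the coefficient row of r, twisted by \<sigma>, times
  \<open>companion f\<close>; the case k = 0 is where the shifted row has no entry.\<close>

lemma skew_mod_X_smul:
  assumes f: "0 < Polynomial.degree f" "lead_coeff f = 1" and r: "r \<in> residues_mod f"
    and k: "k < Polynomial.degree f"
  shows "poly.coeff (skew_mod \<sigma> (Polynomial.monom 1 1 \<odot> r) f) k =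
    (if k = 0 then 0 else \<sigma> (poly.coeff r (k - 1)))
      - \<sigma> (poly.coeff r (Polynomial.degree f - 1)) * poly.coeff f k"
proof -
  define c where "c = \<sigma> (poly.coeff r (Polynomial.degree f - 1))"
  have coeff: "poly.coeff (Polynomial.monom 1 (Suc 0) \<odot> r) k = (if k = 0 then 0 else \<sigma> (poly.coeff r (k - 1)))" for k
  proof -
    have "poly.coeff (Polynomial.monom 1 (Suc 0) \<odot> r) k
      = (\<Sum>i\<le>k. if i = 1 then \<sigma> (poly.coeff r (k - 1)) else 0)"
      unfolding coeff_skew_mult by (intro sum.cong refl) auto
    thus ?thesis by simp
  qed
  have "skew_mod \<sigma> (Polynomial.monom 1 1 \<odot> r) f = Polynomial.monom 1 1 \<odot> r - Polynomial.smult c f"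
  proof (rule skew_mod_eqI)
    have "poly.coeff (Polynomial.monom 1 1 \<odot> r - Polynomial.smult c f) i = 0" if "Polynomial.degree f \<le> i" for i
    proof (cases "i = Polynomial.degree f")
      case True
      thus ?thesis using f by (simp add: coeff c_def)
    next
      case False
      hence "poly.coeff r (i - 1) = 0" "poly.coeff f i = 0"
        using that r residues_mod_iff_coeff[OF f(1)] by (auto intro: coeff_eq_0)
      thus ?thesis by (simp add: coeff)
    qed
    thus "Polynomial.monom 1 1 \<odot> r - Polynomial.smult c f \<in> residues_mod f"
      by (simp add: residues_mod_iff_coeff[OF f(1)])
  qed (simp add: rdvd_smult)
  thus ?thesis by (simp add: coeff c_def)
qed

text \<open>Row i of \<open>P\<close> is the residue of x^i b. Multiplication by x on these rows is
  described once through g and once through f. Comparison of determinants gives the claim, with p =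
  det P and the common sign (-1)^e cancelled.\<close>

lemma similar_constant_coeff:
  assumes f: "nc_irreducible R f" "lead_coeff f = 1"
    and g: "lead_coeff g = 1" "Polynomial.degree g = Polynomial.degree f"
    and b: "\<not> rdvd f b" "rdvd f (g \<odot> b)"
  shows "\<exists>p. p \<noteq> 0 \<and> poly.coeff g 0 * p = poly.coeff f 0 * \<sigma> p"
proof -
  define e where "e = Polynomial.degree f"
  have e: "0 < e" and f0: "f \<noteq> 0" using nc_irreducibleD[OF f(1)] by (auto simp: e_def)
  define r where "r i = skew_mod \<sigma> (Polynomial.monom 1 i \<odot> b) f" for i
  have r: "r i \<in> residues_mod f" "rdvd f (Polynomial.monom 1 i \<odot> b - r i)" for i
    unfolding r_def by (rule skew_mod[OF f0])+
  define P where "P = mat e e (\<lambda>(i, j). poly.coeff (r i) j)"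
  have P: "P \<in> carrier_mat e e" by (simp add: P_def)
  have C: "companion f \<in> carrier_mat e e" "companion g \<in> carrier_mat e e"
    using g(2) by (auto simp: companion_def e_def)
  \<comment> \<open>x^(i+1) b is x times x^i b, so each row arises from the previous one by the
    semilinear action of x on R/Rf.\<close>
  have step: "poly.coeff (r (Suc i)) k =
    (if k = 0 then 0 else \<sigma> (poly.coeff (r i) (k - 1))) - \<sigma> (poly.coeff (r i) (e - 1)) * poly.coeff f k"
    if k: "k < e" for i k
  proof -
    have "r (Suc i) = skew_mod \<sigma> (Polynomial.monom 1 1 \<odot> (Polynomial.monom 1 i \<odot> b)) f"
      by (simp add: r_def monom_smul_monom flip: smul_assoc)
    also have "\<dots> = skew_mod \<sigma> (Polynomial.monom 1 1 \<odot> r i) f"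
      by (simp add: r_def skew_mod_smul_skew_mod[OF f0])
    finally show ?thesis using skew_mod_X_smul[OF _ f(2) r(1)] e k by (simp add: e_def)
  qed
  \<comment> \<open>As g is monic of degree e and g b lies in Rf, the residue of x^e b is a
    combination of the lower rows.\<close>
  have top: "poly.coeff (r e) k = - (\<Sum>j<e. poly.coeff g j * poly.coeff (r j) k)" for k
  proof -
    have "g = (\<Sum>j\<le>e. Polynomial.smult (poly.coeff g j) (Polynomial.monom 1 j))"
      using poly_as_sum_of_monoms[of g] g(2) by (simp add: smult_monom e_def)
    hence "g \<odot> b = (\<Sum>j\<le>e. Polynomial.smult (poly.coeff g j) (Polynomial.monom 1 j)) \<odot> b" by simp
    also have "\<dots> = (\<Sum>j\<le>e. Polynomial.smult (poly.coeff g j) (Polynomial.monom 1 j \<odot> b))"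
      by (simp only: sum_smul smult_smul)
    finally have gb: "g \<odot> b = (\<Sum>j\<le>e. Polynomial.smult (poly.coeff g j) (Polynomial.monom 1 j \<odot> b))" .
    have "rdvd f (g \<odot> b - (\<Sum>j\<le>e. Polynomial.smult (poly.coeff g j) (Polynomial.monom 1 j \<odot> b - r j)))"
      by (intro rdvd_diff b rdvd_sum rdvd_smult r)
    hence "rdvd f (\<Sum>j\<le>e. Polynomial.smult (poly.coeff g j) (r j))"
      by (simp add: gb smult_diff_right sum_subtractf)
    moreover have "(\<Sum>j\<le>e. Polynomial.smult (poly.coeff g j) (r j)) \<in> residues_mod f"
      using r(1) e by (simp add: residues_mod_iff_coeff coeff_sum e_def)
    ultimately have "(\<Sum>j\<le>e. Polynomial.smult (poly.coeff g j) (r j)) = 0" by (rule rdvd_residue_eq_0)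
    hence "(\<Sum>j\<le>e. poly.coeff g j * poly.coeff (r j) k) = 0"
      by (metis (no_types, lifting) coeff_0 coeff_smult coeff_sum sum.cong)
    moreover have "poly.coeff g e = 1" using g by (simp add: e_def)
    ultimately have "(\<Sum>j<e. poly.coeff g j * poly.coeff (r j) k) + poly.coeff (r e) k = 0"
      by (simp add: lessThan_Suc_atMost[symmetric])
    thus ?thesis by (metis neg_eq_iff_add_eq_0)
  qed
  \<comment> \<open>Row i of both sides is \<open>r (Suc i)\<close>. On the left
    \<open>companion g\<close> shifts the rows, with \<open>top\<close> handling the last one; the
    right side is \<open>step\<close>.\<close>
  have "companion g * P = map_mat \<sigma> P * companion f"
  proof (rule eq_matI)
    fix i k assume "i < dim_row (map_mat \<sigma> P * companion f)" "k < dim_col (map_mat \<sigma> P * companion f)"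
    hence ik: "i < e" "k < e" using P C by auto
    have "(companion g * P) $$ (i, k) = (\<Sum>j<e. companion g $$ (i, j) * poly.coeff (r j) k)"
      using ik C P by (auto simp: scalar_prod_def P_def lessThan_atLeast0 intro!: sum.cong)
    also have "\<dots> = poly.coeff (r (Suc i)) k"
    proof (cases "Suc i < e")
      case True
      hence "(\<Sum>j<e. companion g $$ (i, j) * poly.coeff (r j) k) = (\<Sum>j<e. if j = Suc i then poly.coeff (r j) k else 0)"
        using g(2) by (intro sum.cong) (auto simp: companion_def e_def)
      thus ?thesis using True by simp
    next
      case False
      hence i: "Suc i = e" using ik by simp
      have "(\<Sum>j<e. companion g $$ (i, j) * poly.coeff (r j) k) = (\<Sum>j<e. - (poly.coeff g j * poly.coeff (r j) k))"
        using g(2) i by (intro sum.cong) (auto simp: companion_def e_def)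
      thus ?thesis by (simp add: i top sum_negf)
    qed
    also have "\<dots> = (\<Sum>j<e. \<sigma> (poly.coeff (r i) j) * companion f $$ (j, k))"
    proof -
      obtain N where N: "e = Suc N" using e gr0_implies_Suc by blast
      have "(\<Sum>j<e. \<sigma> (poly.coeff (r i) j) * companion f $$ (j, k))
        = (\<Sum>j<N. if Suc j = k then \<sigma> (poly.coeff (r i) j) else 0) - \<sigma> (poly.coeff (r i) N) * poly.coeff f k"
        using ik N by (simp add: companion_def e_def[symmetric]) (intro sum.cong, auto)
      also have "(\<Sum>j<N. if Suc j = k then \<sigma> (poly.coeff (r i) j) else 0)
        = (if k = 0 then 0 else \<sigma> (poly.coeff (r i) (k - 1)))"
        using ik(2) N by (cases k) auto
      finally show ?thesis using step[OF ik(2)] N by simp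
    qed
    also have "\<dots> = (map_mat \<sigma> P * companion f) $$ (i, k)"
      using ik C P by (auto simp: scalar_prod_def P_def lessThan_atLeast0 intro!: sum.cong)
    finally show "(companion g * P) $$ (i, k) = (map_mat \<sigma> P * companion f) $$ (i, k)" .
  qed (use P C in auto)
  moreover have "det (map_mat \<sigma> P) = \<sigma> (det P)"
  proof -
    interpret \<sigma>: comm_ring_hom \<sigma> by unfold_locales auto
    show ?thesis by simp
  qed
  ultimately have "det (companion g) * det P = \<sigma> (det P) * det (companion f)"
    using det_mult[OF C(2) P] det_mult[OF _ C(1), of "map_mat \<sigma> P"] P by simp
  hence "(- 1) ^ e * (poly.coeff g 0 * det P) = (- 1) ^ e * (poly.coeff f 0 * \<sigma> (det P))"
    using det_companion[of f] det_companion[of g] e g(2) by (simp add: e_def mult_ac)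
  hence "poly.coeff g 0 * det P = poly.coeff f 0 * \<sigma> (det P)" by simp
  \<comment> \<open>A vector in the left kernel of \<open>P\<close> would be the coefficient list of
    a nonzero \<open>h\<close> of degree below e annihilating b, against
    \<open>annihilator_degree_ge\<close>.\<close>
  moreover have "det P \<noteq> 0"
  proof
    assume "det P = 0"
    hence "det (transpose_mat P) = 0" using det_transpose[OF P] by simp
    then obtain v where v: "v \<in> carrier_vec e" "v \<noteq> 0\<^sub>v e" "transpose_mat P *\<^sub>v v = 0\<^sub>v e"
      using det_0_iff_vec_prod_zero_field[of "transpose_mat P" e] P by auto
    define h where "h = (\<Sum>i<e. Polynomial.monom (v $ i) i)"
    have coeff: "poly.coeff h i = (if i < e then v $ i else 0)" for i
      by (simp add: h_def coeff_sum)
    have "h \<noteq> 0" using v(1,2) coeff by (metis coeff_0 eq_vecI carrier_vecD index_zero_vec)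
    moreover have "h \<in> residues_mod f" using e coeff by (simp add: residues_mod_iff_coeff e_def)
    moreover have "rdvd f (h \<odot> b)"
    proof -
      have "(\<Sum>i<e. Polynomial.smult (v $ i) (r i)) = 0"
      proof (rule poly_eqI)
        fix k
        show "poly.coeff (\<Sum>i<e. Polynomial.smult (v $ i) (r i)) k = poly.coeff 0 k"
        proof (cases "k < e")
          case True
          have "(transpose_mat P *\<^sub>v v) $ k = (\<Sum>i<e. v $ i * poly.coeff (r i) k)"
            using True P v(1) by (auto simp: scalar_prod_def P_def lessThan_atLeast0 mult.commute intro!: sum.cong)
          thus ?thesis using v(3) True by (simp add: coeff_sum)
        next
          case False
          thus ?thesis using r(1) e by (simp add: coeff_sum residues_mod_iff_coeff e_def)
        qed
      qed
      moreover have "rdvd f (\<Sum>i<e. Polynomial.smult (v $ i) (Polynomial.monom 1 i \<odot> b - r i))"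
        by (intro rdvd_sum rdvd_smult r)
      moreover have "(\<Sum>i<e. Polynomial.smult (v $ i) (Polynomial.monom 1 i \<odot> b - r i))
        = h \<odot> b - (\<Sum>i<e. Polynomial.smult (v $ i) (r i))"
        by (simp add: h_def smult_diff_right sum_subtractf sum_smul smult_monom flip: smult_smul)
      ultimately show ?thesis by simp
    qed
    ultimately show False
      using annihilator_degree_ge[OF f(1) b(1), of h] by (auto simp: residues_mod_def)
  qed
  ultimately show ?thesis by blast
qed

subsection \<open>Central elements and irreducible factors\<close>

definition central :: "'a poly \<Rightarrow> bool"
  where "central p \<longleftrightarrow> (\<forall>q. p \<odot> q = q \<odot> p)"

lemma central_iff_ring_center: "p \<in> ring_center R \<longleftrightarrow> central p"
  by (simp add: ring_center_def central_def)

lemma centralD: "central p \<Longrightarrow> p \<odot> q = q \<odot> p"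
  by (simp add: central_def)

lemma central_add: "central p \<Longrightarrow> central q \<Longrightarrow> central (p + q)"
  by (simp add: central_def smul_add add_smul)

lemma central_smul: "central p \<Longrightarrow> central q \<Longrightarrow> central (p \<odot> q)"
  unfolding central_def by (metis smul_assoc)

lemma central_const: "\<sigma> c = c \<Longrightarrow> central [:c:]"
  by (simp add: central_def smul_const_fixed)

lemma central_monom:
  assumes "\<sigma> ^^ k = id"
  shows "central (Polynomial.monom 1 k)"
  unfolding central_def
proof
  fix q
  show "Polynomial.monom 1 k \<odot> q = q \<odot> Polynomial.monom 1 k"
    by (induct q rule: poly_monom_induct)
      (simp_all add: monom_smul_monom smul_add add_smul assms add.commute)
qed

lemma central_in_power:
  assumes "\<sigma> ^^ n = id" "\<And>i. \<sigma> (poly.coeff p i) = poly.coeff p i"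
  shows "central (in_power p n)"
  using assms(2)
proof (induct p)
  case 0
  show ?case by (simp add: central_def)
next
  case (pCons a p)
  \<comment> \<open>\<open>in_power\<close> is built with the commutative product. Multiplication by
    x^n on the left agrees in both rings because \<sigma>^n is the identity.\<close>
  have mult: "Polynomial.monom 1 n * g = Polynomial.monom 1 n \<odot> g" for g
    by (induct g rule: poly_monom_induct)
      (simp_all add: monom_smul_monom mult_monom smul_add distrib_left assms(1))
  have "\<sigma> a = a" using pCons(3)[of 0] by simp
  moreover have "central (in_power p n)"
    using pCons(3)[of "Suc _"] by (intro pCons(2)) simp
  ultimately show ?case
    by (simp add: pcompose_pCons mult central_add central_smul central_const central_monom assms(1))
qed

text \<open>The factors of a nonzero central element can be rotated cyclically: in Z a = a Z the
  factor a cancels on the left, and then p cancels in Z p = p Z.\<close>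

lemma central_factor_commutes:
  assumes Z: "central Z" "Z \<noteq> 0" "Z = a \<odot> (p \<odot> b)"
  shows "Z = b \<odot> a \<odot> p" "Z = p \<odot> (b \<odot> a)"
proof -
  have nz: "a \<noteq> 0" "p \<noteq> 0" using Z(2,3) by auto
  have "a \<odot> (p \<odot> (b \<odot> a)) = Z \<odot> a" by (simp add: Z(3) smul_assoc)
  also have "\<dots> = a \<odot> Z" by (rule centralD[OF Z(1)])
  finally show 1: "Z = p \<odot> (b \<odot> a)" using smul_left_cancel[OF nz(1)] by metis
  have "p \<odot> (b \<odot> a \<odot> p) = Z \<odot> p" by (subst 1) (simp add: smul_assoc)
  also have "\<dots> = p \<odot> Z" by (rule centralD[OF Z(1)])
  finally show "Z = b \<odot> a \<odot> p" using smul_left_cancel[OF nz(2)] by metis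
qed

text \<open>If left multiplication by \<open>p\<close> were injective on \<open>R/Rf\<close>, the cofactor of \<open>p\<close> in the bound
  would annihilate \<open>R/Rf\<close>, hence be a multiple of the bound.\<close>

lemma factor_of_bound_annihilates:
  assumes Z: "is_bound \<sigma> f Z" "Z \<noteq> 0" "Z = a \<odot> (p \<odot> b)" and p: "nc_irreducible R p"
  shows "\<exists>v. \<not> rdvd f v \<and> rdvd f (p \<odot> v)"
proof (rule ccontr)
  assume contra: "\<not> ?thesis"
  have central: "central Z" and sub: "rdvd f Z"
    and bound: "\<And>I. ideal I R \<Longrightarrow> I \<subseteq> PIdl\<^bsub>R\<^esub> f \<Longrightarrow> I \<subseteq> PIdl\<^bsub>R\<^esub> Z"
    using Z(1) by (auto simp: is_bound_def Let_def central_iff_ring_center PIdl_iff_rdvd subset_iff)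
  define c where "c = b \<odot> a"
  have c: "Z = p \<odot> c" using central_factor_commutes(2)[OF central Z(2,3)] by (simp add: c_def)
  \<comment> \<open>The annihilator of the module R/Rf. It is a two-sided ideal and, by its action
    on 1, lies in Rf, hence in RZ.\<close>
  define I where "I = {g. \<forall>v. rdvd f (g \<odot> v)}"
  have "c \<in> I"
    unfolding I_def
  proof (intro CollectI allI)
    fix v
    \<comment> \<open>The product p c is Z, which is central and lies in Rf. Injectivity of p on
      R/Rf, which is \<open>contra\<close>, then removes p.\<close>
    have "p \<odot> (c \<odot> v) = v \<odot> Z" by (metis c centralD[OF central] smul_assoc)
    hence "rdvd f (p \<odot> (c \<odot> v))" using rdvd_smul[OF sub] by simp
    thus "rdvd f (c \<odot> v)" using contra by blast
  qed
  moreover have "ideal I R"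
  proof (rule idealI[OF ring_R])
    show "subgroup I (add_monoid R)"
    proof (rule group.subgroupI)
      show "Group.group (add_monoid R)"
        using ring_R ring_def abelian_group.a_group by blast
      show "I \<noteq> {}" by (auto simp: I_def intro!: exI[of _ 0])
      fix g assume g: "g \<in> I"
      have "inv\<^bsub>add_monoid R\<^esub> g = - g"
        using abelian_group.minus_equality[of R "- g" g] ring.is_abelian_group[OF ring_R]
        by (simp add: a_inv_def)
      thus "inv\<^bsub>add_monoid R\<^esub> g \<in> I" using g rdvd_diff[of f 0] by (auto simp: I_def uminus_smul)
    qed (auto simp: I_def add_smul rdvd_add)
  qed (auto simp: I_def smul_assoc rdvd_smul)
  moreover have "I \<subseteq> PIdl\<^bsub>R\<^esub> f"
  proof
    fix g assume "g \<in> I"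
    hence "rdvd f (g \<odot> 1)" unfolding I_def by blast
    thus "g \<in> PIdl\<^bsub>R\<^esub> f" by (simp add: PIdl_iff_rdvd)
  qed
  ultimately have "rdvd Z c" using bound PIdl_iff_rdvd by blast
  then obtain q where "c = q \<odot> Z" by (auto simp: rdvd_def)
  hence "p \<odot> q \<odot> Z = 1 \<odot> Z" using c by (simp add: smul_assoc)
  hence pq: "p \<odot> q = 1" by (rule smul_right_cancel[OF Z(2)])
  hence "p \<noteq> 0" "q \<noteq> 0" by auto
  hence "Polynomial.degree p = 0" using degree_skew_mult[of p q] pq by simp
  thus False using nc_irreducibleD(2)[OF p] by simp
qed

lemma foldr_factor:
  assumes "p \<in> set ps"
  shows "\<exists>a b. foldr (\<odot>) ps 1 = a \<odot> (p \<odot> b)"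
  using assms
proof (induct ps)
  case (Cons q ps)
  show ?case
  proof (cases "p = q")
    case True
    thus ?thesis by (intro exI[of _ 1] exI[of _ "foldr (\<odot>) ps 1"]) simp
  next
    case False
    then obtain a b where "foldr (\<odot>) ps 1 = a \<odot> (p \<odot> b)" using Cons by auto
    thus ?thesis by (intro exI[of _ "q \<odot> a"] exI[of _ b]) (simp add: smul_assoc)
  qed
qed simp

lemma degree_foldr:
  assumes "\<And>p. p \<in> set ps \<Longrightarrow> p \<noteq> 0 \<and> Polynomial.degree p = e"
  shows "foldr (\<odot>) ps 1 \<noteq> 0 \<and> Polynomial.degree (foldr (\<odot>) ps 1) = length ps * e"
  using assms by (induct ps) (auto simp: degree_skew_mult)

text \<open>Each irreducible factor of the bound annihilates a nonzero class of R/Rf, so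
  \<open>similar_irreducible_degree\<close> gives it the degree of f.\<close>

lemma degree_bound_eq:
  assumes f: "nc_irreducible R f" and Z: "is_bound \<sigma> f Z" "has_irreducible_factors R Z m"
  shows "Polynomial.degree Z = m * Polynomial.degree f"
proof -
  have Z0: "Z \<noteq> 0" using Z(1) by (auto simp: is_bound_def Let_def)
  obtain ps where ps: "length ps = m" "\<And>p. p \<in> set ps \<Longrightarrow> nc_irreducible R p" "Z = foldr (\<odot>) ps 1"
    using Z(2) by (auto simp: has_irreducible_factors_def)
  have "p \<noteq> 0 \<and> Polynomial.degree p = Polynomial.degree f" if p: "p \<in> set ps" for p
  proof -
    obtain a b where "Z = a \<odot> (p \<odot> b)" using foldr_factor[OF p] ps(3) by auto
    from factor_of_bound_annihilates[OF Z(1) Z0 this ps(2)[OF p]]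
    show ?thesis using similar_irreducible_degree[OF f ps(2)[OF p]] nc_irreducibleD(1)[OF ps(2)[OF p]] by blast
  qed
  from degree_foldr[OF this] show ?thesis using ps(1,3) by simp
qed

subsection \<open>Dimension of the residues\<close>

lemma const_ring_hom: "ring_hom_ring fullfield R (\<lambda>c. [:c:])"
  by (intro ring_hom_ringI2 ring_from_type_algebra ring_R ring_hom_memI) (auto simp: one_pCons)

lemma subfield_const: "subfield K fullfield \<Longrightarrow> subfield ((\<lambda>c. [:c:]) ` K) R"
  using ring_hom_ring.img_is_subfield(2)[OF const_ring_hom, of K] by simp

text \<open>Each step of the induction adjoins the line spanned by x^e. Bounding the coefficients
  instead of the degree lets the induction start with the zero space.\<close>

lemma dimension_const_residues: "ring.dimension R e (range (\<lambda>c. [:c:])) {p. \<forall>i\<ge>e. poly.coeff p i = 0}"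
proof -
  interpret R: ring R by (rule ring_R)
  show ?thesis
  proof (induct e)
    case 0
    have "{p :: 'a poly. \<forall>i\<ge>0. poly.coeff p i = 0} = {\<zero>\<^bsub>R\<^esub>}"
      by (auto simp: poly_eq_iff)
    thus ?case using R.zero_dim by metis
  next
    case (Suc e)
    have "R.line_extension (range (\<lambda>c. [:c:])) (Polynomial.monom 1 e) {p. \<forall>i\<ge>e. poly.coeff p i = 0}
      = {p. \<forall>i\<ge>Suc e. poly.coeff p i = 0}" (is "?L = ?E")
    proof (intro equalityI subsetI)
      fix p assume "p \<in> ?L"
      thus "p \<in> ?E" by (auto simp: R.line_extension_mem_iff)
    next
      fix p assume p: "p \<in> ?E"
      let ?q = "p - Polynomial.monom (poly.coeff p e) e"
      have "p = [:poly.coeff p e:] \<otimes>\<^bsub>R\<^esub> Polynomial.monom 1 e \<oplus>\<^bsub>R\<^esub> ?q"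
        by (simp add: smult_monom)
      moreover have "poly.coeff ?q i = 0" if "e \<le> i" for i
        using p that by (cases "i = e") auto
      hence "?q \<in> {p. \<forall>i\<ge>e. poly.coeff p i = 0}" by blast
      ultimately show "p \<in> ?L" unfolding R.line_extension_mem_iff by blast
    qed
    moreover have "Polynomial.monom 1 e \<notin> {p :: 'a poly. \<forall>i\<ge>e. poly.coeff p i = 0}" by auto
    ultimately show ?case using R.Suc_dim[OF _ _ Suc, of "Polynomial.monom 1 e"] by simp
  qed
qed

lemma dimension_residues_mod:
  assumes K: "subfield K fullfield" "fullfield.dimension N K UNIV" and e: "0 < Polynomial.degree f"
  shows "algebra_dimension \<sigma> K (residues_mod f) (N * Polynomial.degree f)"
proof -
  interpret R: ring R by (rule ring_R)
  have "R.dimension N ((\<lambda>c. [:c:]) ` K) (range (\<lambda>c. [:c:]))"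
    using ring_hom_ring.inj_hom_dimension[OF const_ring_hom K(1) _ _ K(2)] by (simp add: inj_def)
  moreover have "subfield (range (\<lambda>c. [:c:])) R"
    using subfield_const[of UNIV] field.carrier_is_subfield[OF field_from_type_algebra] by simp
  moreover have "R.dimension (Polynomial.degree f) (range (\<lambda>c. [:c:])) (residues_mod f)"
  proof -
    have "residues_mod f = {p. \<forall>i\<ge>Polynomial.degree f. poly.coeff p i = 0}"
      unfolding set_eq_iff mem_Collect_eq residues_mod_iff_coeff[OF e] by (rule allI, rule refl)
    thus ?thesis using dimension_const_residues by simp
  qed
  ultimately show ?thesis
    unfolding algebra_dimension_def using R.telescopic_base subfield_const[OF K(1)] by blast
qed

text \<open>By finite dimension, bijectivity of the one-sided multiplications reduces to the absence
  of zero divisors.\<close>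

lemma injective_linear_bij_residues_mod:
  fixes \<phi> :: "'a poly \<Rightarrow> 'a poly"
  assumes K: "subfield K fullfield" "fullfield.dimension N K UNIV" and e: "0 < Polynomial.degree f"
    and closed: "\<And>v. v \<in> residues_mod f \<Longrightarrow> \<phi> v \<in> residues_mod f"
    and add: "\<And>u v. u \<in> residues_mod f \<Longrightarrow> v \<in> residues_mod f \<Longrightarrow> \<phi> (u + v) = \<phi> u + \<phi> v"
    and scale: "\<And>k v. k \<in> K \<Longrightarrow> v \<in> residues_mod f \<Longrightarrow> \<phi> (Polynomial.smult k v) = Polynomial.smult k (\<phi> v)"
    and ker: "\<And>v. v \<in> residues_mod f \<Longrightarrow> \<phi> v = 0 \<Longrightarrow> v = 0"
  shows "bij_betw \<phi> (residues_mod f) (residues_mod f)"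
  unfolding bij_betw_def
proof
  interpret R: ring R by (rule ring_R)
  show "inj_on \<phi> (residues_mod f)"
  proof (rule inj_onI)
    fix u v assume uv: "u \<in> residues_mod f" "v \<in> residues_mod f" "\<phi> u = \<phi> v"
    have "\<phi> u = \<phi> (u - v) + \<phi> v"
      using add[OF residues_mod_closed(2)[OF uv(1,2)] uv(2)] by simp
    hence "\<phi> (u - v) = 0" using uv(3) by simp
    hence "u - v = 0" by (rule ker[OF residues_mod_closed(2)[OF uv(1,2)]])
    thus "u = v" by simp
  qed
  show "\<phi> ` residues_mod f = residues_mod f"
    using dimension_residues_mod[OF K e] closed add scale ker
    by (intro R.injective_linear_endo_surj[OF subfield_const[OF K(1)]]) (auto simp: algebra_dimension_def)
qed

end

section \<open>The twisted multiplication\<close>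

text \<open>Here \<open>K\<close> is the field of scalars of the algebra, called K' in the theorem,
  and \<open>N\<close> is the degree of L over it.\<close>

locale twisted_quotient = skew_polynomials +
  fixes f \<rho> \<eta> K N
  assumes irred: "nc_irreducible (skew_poly_ring \<sigma>) f" and monic: "lead_coeff f = 1"
    and \<rho>: "\<rho> \<in> field_auts"
    and K: "subfield K fullfield" "fullfield.dimension N K UNIV"
    and \<rho>_fixes: "\<And>k. k \<in> K \<Longrightarrow> \<rho> k = k" and \<sigma>_fixes: "\<And>k. k \<in> K \<Longrightarrow> \<sigma> k = k"
    and norm: "field_norm K (\<eta> * poly.coeff f 0) \<noteq> 1"
begin

abbreviation A :: "'a poly set" where "A \<equiv> residues_mod f"
abbreviation lift :: "'a poly \<Rightarrow> 'a poly" where "lift \<equiv> twist_lift \<eta> \<rho> f"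
abbreviation tc :: "'a poly \<Rightarrow> 'a" where "tc \<equiv> twist_coeff \<eta> \<rho> f"

lemmas \<rho>_simps [simp] = field_autsD(1-3)[OF \<rho>] field_auts_simps[OF \<rho>]
lemmas f_nz [simp] = nc_irreducibleD(1)[OF irred]
lemmas deg_f [simp] = nc_irreducibleD(2)[OF irred]

text \<open>The only place where the norm condition enters. It serves twice: with p = 1 for the
  bijectivity of the twist, and with p a determinant for the absence of zero divisors.\<close>

lemma no_twisted_fixed_point:
  assumes "p \<noteq> 0" "a * p = \<eta> * \<rho> a * poly.coeff f 0 * \<sigma> p"
  shows "a = 0"
proof (rule ccontr)
  assume "a \<noteq> 0"
  obtain us where us: "field_basis K us" using field_basis_exists[OF K] by auto
  have "a * p = (\<eta> * poly.coeff f 0) * \<sigma> p * \<rho> a" by (simp add: assms(2) mult_ac)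
  from field_norm_eq_one_if_twisted_fixed_point[OF K(1) us \<rho> \<rho>_fixes aut \<sigma>_fixes \<open>a \<noteq> 0\<close> assms(1) this]
  show False using norm by simp
qed

text \<open>Injectivity is the case p = 1 of \<open>no_twisted_fixed_point\<close>, and surjectivity
  follows by K-linearity on the finite-dimensional L. It gives existence and uniqueness of the a_0
  in \<open>twist_coeff\<close>.\<close>

lemma twist_bij: "bij (\<lambda>a. a - \<eta> * \<rho> a * poly.coeff f 0)" (is "bij ?T")
  unfolding bij_def
proof
  have add: "?T (a + b) = ?T a + ?T b" for a b by (simp add: algebra_simps)
  have ker: "a = 0" if "?T a = 0" for a using no_twisted_fixed_point[of 1 a] that by simp
  show "inj ?T"
  proof (rule injI)
    fix a b assume ab: "?T a = ?T b"
    have "?T (a - b) = ?T a - ?T b" by (simp add: algebra_simps)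
    also have "\<dots> = 0" unfolding ab by simp
    finally have "a - b = 0" by (rule ker)
    thus "a = b" by simp
  qed
  show "surj ?T"
    using ker by (intro fullfield.injective_linear_endo_surj[OF K]) (auto simp: algebra_simps \<rho>_fixes)
qed

lemma twist_coeff: "tc u - \<eta> * \<rho> (tc u) * poly.coeff f 0 = poly.coeff u 0"
proof -
  have "\<exists>!a. a - \<eta> * \<rho> a * poly.coeff f 0 = poly.coeff u 0"
    using bij_is_surj[OF twist_bij] bij_is_inj[OF twist_bij] unfolding surj_def inj_def by metis
  from theI'[OF this] show ?thesis by (simp add: twist_coeff_def)
qed

lemma twist_coeff_eqI: "a - \<eta> * \<rho> a * poly.coeff f 0 = poly.coeff u 0 \<Longrightarrow> tc u = a"
  using twist_coeff[of u] bij_is_inj[OF twist_bij] by (metis (no_types, lifting) injD)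

lemma twist_lift_add: "lift (u + v) = lift u + lift v"
proof -
  have "tc (u + v) = tc u + tc v"
  proof (rule twist_coeff_eqI)
    have "tc u + tc v - \<eta> * \<rho> (tc u + tc v) * poly.coeff f 0
      = (tc u - \<eta> * \<rho> (tc u) * poly.coeff f 0) + (tc v - \<eta> * \<rho> (tc v) * poly.coeff f 0)"
      by (simp add: algebra_simps)
    thus "tc u + tc v - \<eta> * \<rho> (tc u + tc v) * poly.coeff f 0 = poly.coeff (u + v) 0"
      by (simp only: twist_coeff coeff_add)
  qed
  thus ?thesis by (simp add: twist_lift_def smult_add_left algebra_simps)
qed

lemma twist_lift_smult:
  assumes "c \<in> K"
  shows "lift (Polynomial.smult c u) = Polynomial.smult c (lift u)"
proof -
  have "tc (Polynomial.smult c u) = c * tc u"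
  proof (rule twist_coeff_eqI)
    have "c * tc u - \<eta> * \<rho> (c * tc u) * poly.coeff f 0
      = c * (tc u - \<eta> * \<rho> (tc u) * poly.coeff f 0)"
      by (simp add: algebra_simps \<rho>_fixes[OF assms])
    thus "c * tc u - \<eta> * \<rho> (c * tc u) * poly.coeff f 0 = poly.coeff (Polynomial.smult c u) 0"
      by (simp only: twist_coeff coeff_smult)
  qed
  thus ?thesis by (simp add: twist_lift_def smult_add_right \<rho>_fixes[OF assms] mult_ac)
qed

lemma twist_lift_eq_self: "poly.coeff u 0 = 0 \<Longrightarrow> lift u = u"
  using twist_coeff_eqI[of 0 u] by (simp add: twist_lift_def)

lemma rdvd_twist_lift_diff: "rdvd f (lift u - u)"
  by (simp add: twist_lift_def rdvd_smult)

text \<open>The lift of u has coefficient c = \<eta> \<rho>(a_0) at x^e. If c = 0, its degree is too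
  small to annihilate v. Otherwise the lift divided by c is monic of degree e, and
  \<open>similar_constant_coeff\<close> leads to a twisted fixed point.\<close>

lemma star_S_no_zero_divisors:
  assumes u: "u \<in> A" and v: "v \<in> A" "v \<noteq> 0" and 0: "star_S \<sigma> \<eta> \<rho> f u v = 0"
  shows "u = 0"
proof (rule ccontr)
  assume "u \<noteq> 0"
  have v': "\<not> rdvd f v" using rdvd_residue_eq_0 v by blast
  have lv: "rdvd f (lift u \<odot> v)" using 0 by (simp add: star_S_def skew_mod_eq_0_iff)
  define e where "e = Polynomial.degree f"
  define c where "c = \<eta> * \<rho> (tc u)"
  have ue: "poly.coeff u i = 0" if "e \<le> i" for i
    using u that by (simp add: residues_mod_iff_coeff e_def)
  show False
  proof (cases "c = 0")
    case True
    hence "lift u = u" by (simp add: twist_lift_def c_def)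
    hence "e \<le> Polynomial.degree u"
      using annihilator_degree_ge[OF irred v' \<open>u \<noteq> 0\<close>] lv by (simp add: e_def)
    thus False using u \<open>u \<noteq> 0\<close> by (simp add: residues_mod_def e_def)
  next
    case False
    define g where "g = Polynomial.smult (inverse c) (lift u)"
    have lead: "poly.coeff g e = 1"
      using False monic ue[of e] by (simp add: g_def twist_lift_def e_def flip: c_def)
    have "Polynomial.degree g \<le> e"
      by (rule degree_le) (auto simp: g_def twist_lift_def ue e_def coeff_eq_0)
    hence deg: "Polynomial.degree g = e" using lead le_degree[of g e] by simp
    have "rdvd f (g \<odot> v)" using lv by (simp add: g_def smult_smul rdvd_smult)
    then obtain p where p: "p \<noteq> 0" "poly.coeff g 0 * p = poly.coeff f 0 * \<sigma> p"
      using similar_constant_coeff[OF irred monic _ _ v'] lead deg by (auto simp: e_def)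
    \<comment> \<open>The constant coefficient of the lift is a_0 itself, since the added multiple
      of f restores the subtracted term.\<close>
    have "tc u = poly.coeff u 0 + c * poly.coeff f 0"
      using twist_coeff[of u] by (simp only: c_def diff_eq_eq)
    moreover have "poly.coeff g 0 = inverse c * (poly.coeff u 0 + c * poly.coeff f 0)"
      by (simp add: g_def twist_lift_def flip: c_def)
    ultimately have g0: "poly.coeff g 0 = inverse c * tc u" by metis
    have "tc u * p = \<eta> * \<rho> (tc u) * poly.coeff f 0 * \<sigma> p"
    proof -
      have "tc u * p = c * (poly.coeff g 0 * p)"
        using g0 False by simp
      thus ?thesis by (simp only: p(2) c_def mult.assoc)
    qed
    hence "tc u = 0" by (rule no_twisted_fixed_point[OF p(1)])
    thus False using False by (simp add: c_def)
  qed
qed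

lemma star_S_division_algebra: "division_algebra_over K A (star_S \<sigma> \<eta> \<rho> f)"
proof -
  let ?S = "star_S \<sigma> \<eta> \<rho> f"
  have closed: "?S u v \<in> A" for u v by (simp add: star_S_def skew_mod(1))
  have add: "?S (u + v) w = ?S u w + ?S v w" "?S w (u + v) = ?S w u + ?S w v" for u v w
    by (simp_all add: star_S_def twist_lift_add add_smul smul_add skew_mod_add)
  have scale: "?S (Polynomial.smult c u) v = Polynomial.smult c (?S u v)"
    "?S u (Polynomial.smult c v) = Polynomial.smult c (?S u v)" if "c \<in> K" for c u v
    by (simp_all add: star_S_def twist_lift_smult[OF that] smult_smul smul_smult_fixed[OF \<sigma>_fixes[OF that]] skew_mod_smult)
  have "1 \<in> A" by (simp add: residues_mod_def)
  hence "A \<noteq> {0}" by auto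
  moreover have "bij_betw (?S u) A A" if u: "u \<in> A - {0}" for u
  proof (rule injective_linear_bij_residues_mod[OF K deg_f])
    fix v assume "v \<in> A" "?S u v = 0"
    thus "v = 0" using star_S_no_zero_divisors[of u v] u by blast
  qed (simp_all add: closed add scale)
  moreover have "bij_betw (\<lambda>v. ?S v u) A A" if u: "u \<in> A - {0}" for u
  proof (rule injective_linear_bij_residues_mod[OF K deg_f])
    fix v assume "v \<in> A" "?S v u = 0"
    thus "v = 0" using star_S_no_zero_divisors[of v u] u by blast
  qed (simp_all add: closed add scale)
  ultimately show ?thesis
    using K(1) closed add scale
    by (auto simp: division_algebra_over_def algebra_over_def residues_mod_closed residues_mod_smult)
qed

lemma bij_star_S: "u \<in> A - {0} \<Longrightarrow> bij_betw (star_S \<sigma> \<eta> \<rho> f u) A A"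
  "u \<in> A - {0} \<Longrightarrow> bij_betw (\<lambda>v. star_S \<sigma> \<eta> \<rho> f v u) A A"
  using star_S_division_algebra by (auto simp: division_algebra_over_def)

end

section \<open>The inverse of x modulo f and the second multiplication\<close>

locale twisted_quotient_X_inverse = twisted_quotient +
  fixes z n s
  assumes z_central: "central (in_power z n)"
    and power_central: "central (Polynomial.monom 1 (s * n))"
    and sn: "0 < s * n"
    and inverse: "rdvd f (in_power z n \<odot> Polynomial.monom 1 (s * n) - 1)"
begin

abbreviation xx :: "'a poly" where "xx \<equiv> Polynomial.monom 1 1"

definition xinv :: "'a poly" where "xinv = in_power z n \<odot> Polynomial.monom 1 (s * n - 1)"

lemma xinv_xx: "xinv \<odot> xx = in_power z n \<odot> Polynomial.monom 1 (s * n)"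
  and xx_xinv: "xx \<odot> xinv = in_power z n \<odot> Polynomial.monom 1 (s * n)"
proof -
  show "xinv \<odot> xx = in_power z n \<odot> Polynomial.monom 1 (s * n)"
    using sn unfolding xinv_def smul_assoc monom_smul_monom by simp
  have "xx \<odot> xinv = in_power z n \<odot> (xx \<odot> Polynomial.monom 1 (s * n - 1))"
    unfolding xinv_def by (metis centralD[OF z_central] smul_assoc)
  thus "xx \<odot> xinv = in_power z n \<odot> Polynomial.monom 1 (s * n)"
    using sn by (simp add: monom_smul_monom)
qed

text \<open>Rf is only a left ideal, so the congruence \<open>inverse\<close> cannot simply be
  multiplied by v on the right. Centrality of z(x^n) x^(sn) moves v to the left.\<close>

lemma rdvd_unit_diff: "rdvd f (in_power z n \<odot> Polynomial.monom 1 (s * n) \<odot> v - v)"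
proof -
  have "in_power z n \<odot> Polynomial.monom 1 (s * n) \<odot> v - v
    = v \<odot> (in_power z n \<odot> Polynomial.monom 1 (s * n) - 1)"
    by (simp add: smul_diff centralD[OF central_smul[OF z_central power_central]])
  thus ?thesis by (simp add: rdvd_smul inverse)
qed

definition \<phi> :: "'a poly \<Rightarrow> 'a poly" where "\<phi> v = skew_mod \<sigma> (xinv \<odot> v) f"

text \<open>Left multiplication by x on R/Rf is the inverse map, because both products of x and
  \<open>xinv\<close> equal z(x^n) x^(sn), which acts as the identity.\<close>

lemma \<phi>_bij: "bij_betw \<phi> A A"
proof (rule bij_betw_byWitness[where f' = "\<lambda>v. skew_mod \<sigma> (xx \<odot> v) f"])
  have "skew_mod \<sigma> (xinv \<odot> skew_mod \<sigma> (xx \<odot> v) f) f = v" if "v \<in> A" for v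
    unfolding skew_mod_smul_skew_mod[OF f_nz] smul_assoc[symmetric] xinv_xx
    using rdvd_unit_diff that by (rule skew_mod_eqI[rotated])
  thus "\<forall>v\<in>A. \<phi> (skew_mod \<sigma> (xx \<odot> v) f) = v" by (simp add: \<phi>_def)
  have "skew_mod \<sigma> (xx \<odot> skew_mod \<sigma> (xinv \<odot> v) f) f = v" if "v \<in> A" for v
    unfolding skew_mod_smul_skew_mod[OF f_nz] smul_assoc[symmetric] xx_xinv
    using rdvd_unit_diff that by (rule skew_mod_eqI[rotated])
  thus "\<forall>v\<in>A. skew_mod \<sigma> (xx \<odot> \<phi> v) f = v" by (simp add: \<phi>_def)
qed (auto simp: \<phi>_def skew_mod(1))

lemma \<phi>_add: "\<phi> (u + v) = \<phi> u + \<phi> v"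
  by (simp add: \<phi>_def smul_add skew_mod_add)

lemma \<phi>_smult: "c \<in> K \<Longrightarrow> \<phi> (Polynomial.smult c v) = Polynomial.smult c (\<phi> v)"
  by (simp add: \<phi>_def smul_smult_fixed \<sigma>_fixes skew_mod_smult)

lemma \<phi>_closed: "\<phi> v \<in> A"
  by (simp add: \<phi>_def skew_mod(1))

lemma \<phi>_eq_0:
  assumes "v \<in> A" "\<phi> v = 0"
  shows "v = 0"
proof -
  have "\<phi> 0 = 0" by (simp add: \<phi>_def skew_mod_residue)
  thus ?thesis using inj_onD[OF bij_betw_imp_inj_on[OF \<phi>_bij], of v 0] assms by simp
qed

text \<open>Reducing the right-hand factor first absorbs \<open>xinv\<close> into the second
  argument, so the properties of \<open>star_S\<close> transfer through the linear bijection
  \<open>\<phi>\<close>.\<close>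

lemma star_S'_eq: "star_S' \<sigma> \<eta> \<rho> f n s z u v = star_S \<sigma> \<eta> \<rho> f u (\<phi> v)"
  unfolding star_S'_def star_S_def \<phi>_def skew_mod_smul_skew_mod[OF f_nz] xinv_def
  by (simp only: smul_assoc)

lemma star_S'_division_algebra: "division_algebra_over K A (star_S' \<sigma> \<eta> \<rho> f n s z)"
proof -
  note S = star_S_division_algebra
  have "bij_betw (\<lambda>v. star_S \<sigma> \<eta> \<rho> f u (\<phi> v)) A A" if "u \<in> A - {0}" for u
    using bij_betw_trans[OF \<phi>_bij bij_star_S(1)[OF that]] by (simp add: comp_def)
  moreover have "bij_betw (\<lambda>v. star_S \<sigma> \<eta> \<rho> f v (\<phi> u)) A A" if "u \<in> A - {0}" for u
    using that \<phi>_eq_0 by (intro bij_star_S(2)) (auto simp: \<phi>_closed)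
  ultimately show ?thesis
    using S unfolding division_algebra_over_def algebra_over_def star_S'_eq
    by (simp add: \<phi>_add \<phi>_smult \<phi>_closed)
qed

lemma star_S'_unity:
  assumes "1 < Polynomial.degree f"
  shows "is_unity A (star_S' \<sigma> \<eta> \<rho> f n s z) [:0, 1:]"
  unfolding is_unity_def
proof (intro conjI ballI)
  have xx: "[:0, 1:] = xx" by (simp add: monom_altdef)
  show "[:0, 1:] \<in> A" using assms by (simp add: residues_mod_def)
  fix u assume u: "u \<in> A"
  show "star_S' \<sigma> \<eta> \<rho> f n s z [:0, 1:] u = u"
  proof -
    \<comment> \<open>The constant coefficient of x is 0, so its twist coefficient is 0 as
      well.\<close>
    have "lift xx = xx" by (rule twist_lift_eq_self) simp
    hence "star_S' \<sigma> \<eta> \<rho> f n s z xx u = skew_mod \<sigma> (xx \<odot> xinv \<odot> u) f"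
      unfolding star_S'_eq star_S_def \<phi>_def skew_mod_smul_skew_mod[OF f_nz] by (simp only: smul_assoc)
    also have "\<dots> = u" unfolding xx_xinv using rdvd_unit_diff u by (rule skew_mod_eqI[rotated])
    finally show ?thesis unfolding xx .
  qed
  show "star_S' \<sigma> \<eta> \<rho> f n s z u [:0, 1:] = u"
  proof -
    have "star_S' \<sigma> \<eta> \<rho> f n s z u xx = skew_mod \<sigma> (lift u \<odot> (xinv \<odot> xx)) f"
      unfolding star_S'_eq star_S_def \<phi>_def skew_mod_smul_skew_mod[OF f_nz] ..
    also have "\<dots> = u"
    proof (rule skew_mod_eqI[OF u])
      \<comment> \<open>Modulo f, the product \<open>xinv \<odot> xx\<close> may be replaced by 1
        behind any left factor, and the lift of u then reduces to u.\<close>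
      have "rdvd f (lift u \<odot> (xinv \<odot> xx - 1) + (lift u - u))"
        unfolding xinv_xx by (intro rdvd_add rdvd_smul inverse rdvd_twist_lift_diff)
      thus "rdvd f (lift u \<odot> (xinv \<odot> xx) - u)" by (simp add: smul_diff)
    qed
    finally show ?thesis unfolding xx .
  qed
qed

text \<open>The isotopism is the identity on results and first arguments and \<open>\<phi>\<close>
  on second arguments.\<close>

lemma isotopic_star_S'_star_S:
  "isotopic A (star_S' \<sigma> \<eta> \<rho> f n s z) A (star_S \<sigma> \<eta> \<rho> f)"
  unfolding isotopic_def
  using \<phi>_bij by (intro exI[of _ id] exI[of _ \<phi>]) (auto simp: \<phi>_add star_S'_eq)

end

section \<open>Scalar field, degrees and conclusion\<close>

lemma fixed_subfield:
  assumes "subfield K fullfield" "\<rho> \<in> field_auts"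
  shows "subfield ({a. \<rho> a = a} \<inter> K) fullfield"
proof (rule field.subfieldI'[OF field_from_type_algebra])
  note K = subfield_fullfieldD[OF assms(1)] and \<rho> = field_autsD[OF assms(2)] field_auts_simps[OF assms(2)]
  show "subring ({a. \<rho> a = a} \<inter> K) fullfield"
    by (rule fullfield.subringI) (auto simp: K \<rho>)
  show "inv\<^bsub>fullfield\<^esub> k \<in> {a. \<rho> a = a} \<inter> K" if "k \<in> {a. \<rho> a = a} \<inter> K - {\<zero>\<^bsub>fullfield\<^esub>}" for k
    using that by (auto simp: fullfield_inv K \<rho>)
qed

text \<open>A monic constant is 1, a unit. Positivity of s lets the exponent sn - 1 be formed and s
  be cancelled in the degree count.\<close>

lemma degree_pos_if_ring_irreducible:
  assumes "subfield K fullfield" "lead_coeff F = 1" "ring_irreducible\<^bsub>subfield_poly_ring K\<^esub> F"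
  shows "0 < Polynomial.degree F"
proof (rule ccontr)
  assume "\<not> ?thesis"
  hence "F = 1" using assms(2) by (metis degree_0_id degree_eq_zeroE gr0I lead_coeff_pCons(2) one_pCons coeff_pCons_0)
  moreover have "1 \<in> Units (subfield_poly_ring K)"
    using subfield_fullfieldD(1,2)[OF assms(1)] by (auto simp: Units_def subfield_poly_ring_def coeff_1)
  ultimately show False using assms(3) by (auto simp: ring_irreducible_def Divisibility.irreducible_def)
qed

theorem mainTheorem13:
  fixes K K' :: "'a::field set" and \<sigma> \<rho> :: "'a \<Rightarrow> 'a" and \<eta> :: 'a
    and f F z :: "'a poly" and n m l s d :: nat
  assumes "cyclic_galois K \<sigma> n" and "n \<ge> 2"
    and "lead_coeff f = 1" and "nc_irreducible (skew_poly_ring \<sigma>) f"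
    and "f \<notin> ring_center (skew_poly_ring \<sigma>)"
    and "lead_coeff F = 1" and "ring_irreducible\<^bsub>subfield_poly_ring K\<^esub> F"
    and "F \<in> carrier (subfield_poly_ring K)"
    and "Polynomial.degree F = s" and "F \<noteq> [:0, 1:]"
    and "is_bound \<sigma> f (in_power F n)"
    and "has_irreducible_factors (skew_poly_ring \<sigma>) (in_power F n) m"
    and "l = n div m" and "Polynomial.degree f = s * l"
    and "\<rho> \<in> field_auts" and "K' = {a. \<rho> a = a} \<inter> K"
    and "ring.dimension fullfield d K' K"
    and "field_norm K' (\<eta> * poly.coeff f 0) \<noteq> 1"
    and "z \<in> carrier (subfield_poly_ring K)"
    and "skew_mult \<sigma> (in_power z n) (Polynomial.monom 1 (s * n)) - 1
           \<in> PIdl\<^bsub>skew_poly_ring \<sigma>\<^esub> f"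
  shows "division_algebra_over K' (residues_mod f) (star_S' \<sigma> \<eta> \<rho> f n s z) \<and>
    (1 < Polynomial.degree f \<longrightarrow>
       is_unity (residues_mod f) (star_S' \<sigma> \<eta> \<rho> f n s z) [:0, 1:]) \<and>
    algebra_dimension \<sigma> K' (residues_mod f) (m * l\<^sup>2 * s * d) \<and>
    division_algebra_over K' (residues_mod f) (star_S \<sigma> \<eta> \<rho> f) \<and>
    isotopic (residues_mod f) (star_S' \<sigma> \<eta> \<rho> f n s z) (residues_mod f) (star_S \<sigma> \<eta> \<rho> f)"
proof -
  have K: "subfield K fullfield" "fullfield.dimension n K UNIV" and gal: "\<sigma> \<in> gal_group K"
    using assms(1) by (auto simp: cyclic_galois_def)
  have \<sigma>: "\<sigma> \<in> field_auts" "\<And>k. k \<in> K \<Longrightarrow> \<sigma> k = k" using gal by (auto simp: gal_group_def)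
  interpret skew_polynomials \<sigma> by unfold_locales (rule \<sigma>)
  have \<sigma>n: "\<sigma> ^^ n = id" by (rule cyclic_galois_funpow_eq_id[OF assms(1)])
  have \<sigma>sn: "\<sigma> ^^ (s * n) = id" by (metis \<sigma>n funpow_mult id_funpow mult.commute)
  have K': "subfield K' fullfield"
    using fixed_subfield[OF K(1) assms(15)] assms(16) by simp
  have dim: "fullfield.dimension (d * n) K' UNIV"
    by (rule fullfield.telescopic_base[OF K' K(1) assms(17) K(2)])
  have s: "0 < s" using degree_pos_if_ring_irreducible[OF K(1) assms(6,7)] assms(9) by simp
  interpret twisted_quotient \<sigma> f \<rho> \<eta> K' "d * n"
    by (intro twisted_quotient.intro twisted_quotient_axioms.intro skew_polynomials_axioms
        assms(3,4,15,18) K' dim) (use assms(16) \<sigma> in auto)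
  have z: "\<sigma> (poly.coeff z i) = poly.coeff z i" for i
    using assms(19) \<sigma>(2) by (auto simp: subfield_poly_ring_def)
  interpret twisted_quotient_X_inverse \<sigma> f \<rho> \<eta> K' "d * n" z n s
    using assms(2,20) s central_in_power[OF \<sigma>n z] central_monom[OF \<sigma>sn]
    by unfold_locales (auto simp: PIdl_iff_rdvd)
  \<comment> \<open>The degree of F(x^n), computed from F and from its m irreducible factors, each
    of degree s l. Cancelling s shows that m divides n exactly, so the natural-number quotient
    \<open>n div m\<close> loses nothing.\<close>
  have "s * n = m * (s * l)"
    using degree_bound_eq[OF assms(4,11,12)] assms(9,14) by (simp add: degree_pcompose degree_monom_eq)
  hence "n = m * l" using s by simp
  hence "d * n * Polynomial.degree f = m * l\<^sup>2 * s * d"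
    using assms(14) by (simp add: power2_eq_square)
  hence "algebra_dimension \<sigma> K' (residues_mod f) (m * l\<^sup>2 * s * d)"
    using dimension_residues_mod[OF K' dim deg_f] by metis
  thus ?thesis
    using star_S'_division_algebra star_S'_unity star_S_division_algebra isotopic_star_S'_star_S by blast
qed

end
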